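(* Let $T$ be a locally finite infinite tree. Then $\mathrm{DN}_{\mathrm{LLY}}(T)<\infty$ if and only if $F_T$ admits a bounded normalized fixed point. Whenever these conditions hold: (a) the bounded normalized fixed point is unique; denote it by $w_T^\star$. It is the unique normalized optimal weight of $T$, and $$\mathrm{DN}_{\mathrm{LLY}}(T)=\sup_{e\in E(T)}w_T^\star(e);$$ (b) every non-pendant edge has zero Lin--Lu--Yau curvature under $w_T^\star$, while every pendant edge has $w_T^\star$-weight $1$; (c) for every exhaustion $T_1\subset T_2\subset\cdots$, $\bigcup_{n\ge1}T_n=T$, by finite subtrees, the sequence $\mathrm{DN}_{\mathrm{LLY}}(T_n)$ is nondecreasing and converges to $\mathrm{DN}_{\mathrm{LLY}}(T)$, and the canonical weights $w_{T_n}^\star$ converge pointwise on $E(T)$ to $w_T^\star$, i.e. $w_{T_n}^\star(e)\to w_T^\star(e)$ for every $e\in E(T)$ (where $w_{T_n}^\star(e)$ is defined for all sufficiently large $n$).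
   Context: Graphs are simple and undirected. Let $d(\cdot,\cdot)$ be the combinatorial graph distance. For a positive edge weight $w:E\to(0,\infty)$ put $d_x^w:=\sum_{y\sim x}w_{xy}$. For $\alpha\in[0,1]$ let $\mu_x^{\alpha,w}$ be the probability measure with $\mu_x^{\alpha,w}(x)=\alpha$, $\mu_x^{\alpha,w}(z)=(1-\alpha)w_{xz}/d_x^w$ for $z\sim x$, and $0$ otherwise. Let $W_1$ be the $1$-Wasserstein distance with respect to $d$. For $x\sim y$ let $\kappa_\alpha^w(x,y):=1-W_1(\mu_x^{\alpha,w},\mu_y^{\alpha,w})$ and define the weighted Lin--Lu--Yau curvature $\kappa_{\mathrm{LLY}}^w(x,y):=\lim_{\alpha\to1^-}\kappa_\alpha^w(x,y)/(1-\alpha)$. For connected locally finite $G$ with $E\neq\varnothing$: $\mathrm{Dist}(w):=\sup_{e\in E}w_e/\inf_{e\in E}w_e$, with value $+\infty$ if the supremum is infinite or the infimum is $0$; a positive weight $w$ is admissible if $\kappa_{\mathrm{LLY}}^w(e)\ge0$ for every $e\in E$; and $\mathrm{DN}_{\mathrm{LLY}}(G):=\inf\{\mathrm{Dist}(w): w \text{ admissible}\}$, with value $+\infty$ if no admissible weight has finite distortion. By convention $\mathrm{DN}_{\mathrm{LLY}}(K_1)=1$. An admissible weight $w$ is optimal if $\mathrm{Dist}(w)=\mathrm{DN}_{\mathrm{LLY}}(G)$. A finite-distortion weight is normalized if $\inf_{e}w_e=1$. An edge of a tree is pendant if it is incident with a leaf (vertex of degree $1$), and non-pendant otherwise. For a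 locally finite tree $T$, $x\in[1,\infty)^{E(T)}$ and an edge $uv$, put $A_{u\mid v}(x):=\sum_{f\ni u,\ f\ne uv}x_f$ (sum over edges $f$ of $T$ incident with $u$ other than $uv$). The map $F_T:[1,\infty)^{E(T)}\to[1,\infty)^{E(T)}$ is $(F_T(x))_{uv}:=\max\{1,\sqrt{A_{u\mid v}(x)A_{v\mid u}(x)}\}$. A vector $x\in[1,\infty)^{E(T)}$ is a fixed point if $F_T(x)=x$, bounded if $\sup_e x_e<\infty$, and normalized if $\inf_e x_e=1$. For a finite tree $S$ with at least one edge, the canonical weight $w_S^\star$ is the fixed point of $F_S$ in $[1,\infty)^{E(S)}$, which the paper shows exists and is unique. *)

theory Defs
  imports "HOL-Probability.Probability_Mass_Function"
begin

record 'a sgraph =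
  verts :: "'a set"
  edges :: "'a set set"

definition simple_graph :: "'a sgraph \<Rightarrow> bool" where
  "simple_graph G \<longleftrightarrow> (\<forall>e\<in>edges G. e \<subseteq> verts G \<and> card e = 2)"

definition nbrs :: "'a sgraph \<Rightarrow> 'a \<Rightarrow> 'a set" where
  "nbrs G x = {y. {x, y} \<in> edges G}"

definition locally_finite :: "'a sgraph \<Rightarrow> bool" where
  "locally_finite G \<longleftrightarrow> (\<forall>x\<in>verts G. finite (nbrs G x))"

definition adj_rel :: "'a sgraph \<Rightarrow> 'a rel" where
  "adj_rel G = {(x, y). {x, y} \<in> edges G}"

definition connected_graph :: "'a sgraph \<Rightarrow> bool" where
  "connected_graph G \<longleftrightarrow>
     verts G \<noteq> {} \<and> (\<forall>x\<in>verts G. \<forall>y\<in>verts G. (x, y) \<in> (adj_rel G)\<^sup>*)"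

text \<open>A pair lies in the n-th relational power of the adjacency relation iff a walk of length n
  joins its components. The distance is meaningful only for vertices in the same component.\<close>

definition graph_dist :: "'a sgraph \<Rightarrow> 'a \<Rightarrow> 'a \<Rightarrow> nat" where
  "graph_dist G x y = (LEAST n. (x, y) \<in> adj_rel G ^^ n)"

definition is_cycle :: "'a sgraph \<Rightarrow> 'a list \<Rightarrow> bool" where
  "is_cycle G xs \<longleftrightarrow> length xs \<ge> 3 \<and> distinct xs \<and>
     (\<forall>i<length xs. {xs ! i, xs ! (Suc i mod length xs)} \<in> edges G)"

definition is_tree :: "'a sgraph \<Rightarrow> bool" where
  "is_tree G \<longleftrightarrow> simple_graph G \<and> connected_graph G \<and> (\<nexists>xs. is_cycle G xs)"

definition subgraph :: "'a sgraph \<Rightarrow> 'a sgraph \<Rightarrow> bool" where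
  "subgraph H G \<longleftrightarrow> verts H \<subseteq> verts G \<and> edges H \<subseteq> edges G"

definition pendant :: "'a sgraph \<Rightarrow> 'a set \<Rightarrow> bool" where
  "pendant G e \<longleftrightarrow> e \<in> edges G \<and> (\<exists>v\<in>e. card (nbrs G v) = 1)"


text \<open>Weights and vectors indexed by the edges are extensional functions (\<open>\<rightarrow>\<^sub>E\<close>), so
  that equality of functions is equality on the edge set.\<close>

definition pos_weight :: "'a sgraph \<Rightarrow> ('a set \<Rightarrow> real) \<Rightarrow> bool" where
  "pos_weight G w \<longleftrightarrow> w \<in> edges G \<rightarrow>\<^sub>E {0<..}"

definition wdeg :: "'a sgraph \<Rightarrow> ('a set \<Rightarrow> real) \<Rightarrow> 'a \<Rightarrow> real" where
  "wdeg G w x = (\<Sum>y\<in>nbrs G x. w {x, y})"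

definition lazy_walk :: "'a sgraph \<Rightarrow> ('a set \<Rightarrow> real) \<Rightarrow> real \<Rightarrow> 'a \<Rightarrow> 'a pmf" where
  "lazy_walk G w \<alpha> x = embed_pmf (\<lambda>z.
     if z = x then \<alpha>
     else if z \<in> nbrs G x then (1 - \<alpha>) * w {x, z} / wdeg G w x
     else 0)"

text \<open>\<open>embed_pmf\<close> yields a pmf with the given mass function only if the masses are nonnegative
  and sum to one.\<close>

lemma pmf_lazy_walk:
  assumes "simple_graph G" "locally_finite G" "pos_weight G w"
    and "x \<in> verts G" "nbrs G x \<noteq> {}" "0 \<le> \<alpha>" "\<alpha> \<le> 1"
  shows "pmf (lazy_walk G w \<alpha> x) z =
     (if z = x then \<alpha>
      else if z \<in> nbrs G x then (1 - \<alpha>) * w {x, z} / wdeg G w x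
      else 0)"
proof -
  let ?f = "\<lambda>z. if z = x then \<alpha>
      else if z \<in> nbrs G x then (1 - \<alpha>) * w {x, z} / wdeg G w x else 0"
  have fin: "finite (nbrs G x)"
    using assms by (auto simp: locally_finite_def)
  have x: "x \<notin> nbrs G x"
    using assms by (auto simp: simple_graph_def nbrs_def)
  have pos: "w {x, y} > 0" if "y \<in> nbrs G x" for y
    using assms that by (auto simp: pos_weight_def nbrs_def PiE_iff)
  have d: "wdeg G w x > 0"
    unfolding wdeg_def using fin assms pos by (intro sum_pos) auto
  have nn: "?f z \<ge> 0" for z
    using assms pos[of z] d by auto
  have "(\<integral>\<^sup>+z. ennreal (?f z) \<partial>count_space UNIV) = (\<Sum>z\<in>insert x (nbrs G x). ennreal (?f z))"
    using fin by (intro nn_integral_count_space') auto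
  also have "\<dots> = ennreal (\<Sum>z\<in>insert x (nbrs G x). ?f z)"
    using nn by (intro sum_ennreal) auto
  also have "(\<Sum>z\<in>insert x (nbrs G x). ?f z) = \<alpha> + (\<Sum>z\<in>nbrs G x. ?f z)"
    using fin x by simp
  also have "(\<Sum>z\<in>nbrs G x. ?f z) = (\<Sum>z\<in>nbrs G x. (1 - \<alpha>) * w {x, z} / wdeg G w x)"
    using x by (intro sum.cong) auto
  also have "\<dots> = 1 - \<alpha>"
    using d by (simp add: wdeg_def flip: sum_distrib_left sum_divide_distrib)
  finally have "(\<integral>\<^sup>+z. ennreal (?f z) \<partial>count_space UNIV) = 1" by simp
  then show ?thesis
    unfolding lazy_walk_def using nn by (intro pmf_embed_pmf) auto
qed

text \<open>Only applied to finitely supported measures. Their couplings are finitely supported too, so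
  the expectation is a finite sum.\<close>

definition wasserstein1 :: "'a sgraph \<Rightarrow> 'a pmf \<Rightarrow> 'a pmf \<Rightarrow> real" where
  "wasserstein1 G p q =
     Inf {measure_pmf.expectation \<pi> (\<lambda>(x, y). real (graph_dist G x y)) | \<pi>.
            map_pmf fst \<pi> = p \<and> map_pmf snd \<pi> = q}"

definition kappa :: "'a sgraph \<Rightarrow> ('a set \<Rightarrow> real) \<Rightarrow> real \<Rightarrow> 'a \<Rightarrow> 'a \<Rightarrow> real" where
  "kappa G w \<alpha> x y = 1 - wasserstein1 G (lazy_walk G w \<alpha> x) (lazy_walk G w \<alpha> y)"

definition kappa_LLY :: "'a sgraph \<Rightarrow> ('a set \<Rightarrow> real) \<Rightarrow> 'a \<Rightarrow> 'a \<Rightarrow> real" where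
  "kappa_LLY G w x y = Lim (at_left 1) (\<lambda>\<alpha>. kappa G w \<alpha> x y / (1 - \<alpha>))"


definition distortion :: "'a sgraph \<Rightarrow> ('a set \<Rightarrow> real) \<Rightarrow> ereal" where
  "distortion G w =
     (if bdd_above (w ` edges G) \<and> (INF e\<in>edges G. w e) \<noteq> 0
      then ereal ((SUP e\<in>edges G. w e) / (INF e\<in>edges G. w e)) else \<infinity>)"

definition admissible :: "'a sgraph \<Rightarrow> ('a set \<Rightarrow> real) \<Rightarrow> bool" where
  "admissible G w \<longleftrightarrow>
     pos_weight G w \<and> (\<forall>x y. {x, y} \<in> edges G \<longrightarrow> kappa_LLY G w x y \<ge> 0)"

text \<open>A connected graph without edges is \<open>K\<^sub>1\<close>, where the value 1 is a convention.\<close>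

definition DN_LLY :: "'a sgraph \<Rightarrow> ereal" where
  "DN_LLY G = (if edges G = {} then 1 else INF w\<in>{w. admissible G w}. distortion G w)"

definition optimal :: "'a sgraph \<Rightarrow> ('a set \<Rightarrow> real) \<Rightarrow> bool" where
  "optimal G w \<longleftrightarrow> admissible G w \<and> distortion G w = DN_LLY G"

definition normalized_weight :: "'a sgraph \<Rightarrow> ('a set \<Rightarrow> real) \<Rightarrow> bool" where
  "normalized_weight G w \<longleftrightarrow>
     pos_weight G w \<and> distortion G w < \<infinity> \<and> (INF e\<in>edges G. w e) = 1"


text \<open>For an edge \<open>e = {u, v}\<close>, \<open>side_sum G u e x\<close> is \<open>A\<^bsub>u|v\<^esub>(x)\<close>, the
  sum of \<open>x\<close> over the edges at \<open>u\<close> other than \<open>e\<close>, and the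
  product over \<open>u \<in> e\<close> below is \<open>A\<^bsub>u|v\<^esub>(x) A\<^bsub>v|u\<^esub>(x)\<close>.\<close>

definition side_sum :: "'a sgraph \<Rightarrow> 'a \<Rightarrow> 'a set \<Rightarrow> ('a set \<Rightarrow> real) \<Rightarrow> real" where
  "side_sum G u e x = (\<Sum>f\<in>{f\<in>edges G. u \<in> f \<and> f \<noteq> e}. x f)"

definition F_map :: "'a sgraph \<Rightarrow> ('a set \<Rightarrow> real) \<Rightarrow> 'a set \<Rightarrow> real" where
  "F_map G x = (\<lambda>e\<in>edges G. max 1 (sqrt (\<Prod>u\<in>e. side_sum G u e x)))"

definition F_fixed_point :: "'a sgraph \<Rightarrow> ('a set \<Rightarrow> real) \<Rightarrow> bool" where
  "F_fixed_point G x \<longleftrightarrow> x \<in> edges G \<rightarrow>\<^sub>E {1..} \<and> F_map G x = x"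

definition bounded_normalized_fp :: "'a sgraph \<Rightarrow> ('a set \<Rightarrow> real) \<Rightarrow> bool" where
  "bounded_normalized_fp G x \<longleftrightarrow>
     F_fixed_point G x \<and> bdd_above (x ` edges G) \<and> (INF e\<in>edges G. x e) = 1"

definition canonical_weight :: "'a sgraph \<Rightarrow> 'a set \<Rightarrow> real" where
  "canonical_weight S = (THE x. F_fixed_point S x)"

definition exhaustion :: "'a sgraph \<Rightarrow> (nat \<Rightarrow> 'a sgraph) \<Rightarrow> bool" where
  "exhaustion T S \<longleftrightarrow>
     (\<forall>n. is_tree (S n) \<and> finite (verts (S n)) \<and> subgraph (S n) T \<and> subgraph (S n) (S (Suc n))) \<and>
     (\<Union>n. verts (S n)) = verts T \<and> (\<Union>n. edges (S n)) = edges T"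

end

theory Submission
  imports Defs
begin

text \<open>Computing the transport cost with a 1-Lipschitz function that decreases along the edge shows that
  on a tree \<open>\<kappa>\<^bsub>LLY\<^esub>(u,v)\<close> has the sign of \<open>w\<^bsub>uv\<^esub>\<^sup>2 - A\<^bsub>u|v\<^esub> A\<^bsub>v|u\<^esub>\<close>. So the admissible weights with values in
  \<open>[1,\<infinity>)\<close> are the supersolutions \<open>F(w) \<le> w\<close>, and below each of them lies a fixed point of the monotone map \<open>F\<close>.

  Along a non-backtracking walk the logarithm of a bounded supersolution is concave and bounded, hence
  nondecreasing with slopes tending to zero, and the walk meets only finitely many branchings. This
  replaces the missing compactness in the maximum principle for the ratio of a fixed point and a
  supersolution: either the fixed point is smaller, or the ratio is constant. Hence a
  bounded normalized fixed point lies below every bounded supersolution, which gives uniqueness and optimality.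
  Supersolutions restrict to subtrees, so the canonical weights of an exhaustion increase, and their limit is a fixed point.\<close>

section \<open>Supersolutions and fixed points\<close>

text \<open>On an infinite tree the ratio of a fixed point \<open>x\<close> and a supersolution
  \<open>y\<close> need not attain its supremum. The argument therefore starts at an arbitrary edge
  with ratio above 1 and follows locally largest ratios. The threshold 1 matters: there
  \<open>x e > y e \<ge> 1\<close>, so the cutoff in \<open>F_map\<close> is inactive and
  \<open>x\<close> satisfies the equation x^2 = A B, which can be compared with the inequality A B
  \<le> y^2. This gives the geometric-mean bound that drives the walk. The equation x^2 = A B is
  homogeneous, so constant ratios above 1 do occur; only the infimum 1 of a normalized fixed point
  excludes them. A competing optimal weight is merely a supersolution with the same supremum.
  Uniqueness among optimal weights is thus more than a comparison of two fixed points and needs a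
  separate rigidity argument.\<close>

definition supersolution :: "'a sgraph \<Rightarrow> ('a set \<Rightarrow> real) \<Rightarrow> bool" where
  "supersolution G x \<longleftrightarrow> x \<in> edges G \<rightarrow>\<^sub>E {1..} \<and> (\<forall>e\<in>edges G. F_map G x e \<le> x e)"

definition nonbacktracking :: "'a sgraph \<Rightarrow> (nat \<Rightarrow> 'a) \<Rightarrow> bool" where
  "nonbacktracking G v \<longleftrightarrow> (\<forall>i. {v i, v (Suc i)} \<in> edges G \<and> v (Suc (Suc i)) \<noteq> v i)"

locale lf_graph =
  fixes G :: "'a sgraph"
  assumes simple: "simple_graph G" and lf: "locally_finite G" and conn: "connected_graph G"
begin

abbreviation "E \<equiv> edges G"
abbreviation "V \<equiv> verts G"

lemma edge_cases:
  assumes "e \<in> E"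
  obtains u v where "e = {u, v}" "u \<noteq> v"
  using simple assms unfolding simple_graph_def by (metis card_2_iff)

lemma edge_obtain_other:
  assumes "e \<in> E" "u \<in> e"
  obtains v where "e = {u, v}" "u \<noteq> v"
proof -
  obtain a b where "e = {a, b}" "a \<noteq> b" by (rule edge_cases[OF assms(1)])
  then show ?thesis using assms(2) that[of b] that[of a] by (auto simp: insert_commute)
qed

lemma edge_neq: "{u, v} \<in> E \<Longrightarrow> u \<noteq> v"
  using simple unfolding simple_graph_def by fastforce

lemma edge_verts: "{u, v} \<in> E \<Longrightarrow> u \<in> V \<and> v \<in> V"
  using simple unfolding simple_graph_def by fastforce

lemma finite_nbrs: "finite (nbrs G u)"
proof (cases "u \<in> V")
  case True
  then show ?thesis using lf by (simp add: locally_finite_def)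
next
  case False
  then have "nbrs G u = {}" using edge_verts by (auto simp: nbrs_def)
  then show ?thesis by simp
qed

lemma edges_at: "{f \<in> E. u \<in> f} = (\<lambda>z. {u, z}) ` nbrs G u"
proof -
  have "f \<in> (\<lambda>z. {u, z}) ` nbrs G u" if f: "f \<in> E" "u \<in> f" for f
  proof -
    obtain z where "f = {u, z}" by (rule edge_obtain_other[OF f])
    then show ?thesis using f by (auto simp: nbrs_def)
  qed
  then show ?thesis by (auto simp: nbrs_def)
qed

lemma finite_edges_at: "finite {f \<in> E. u \<in> f \<and> f \<noteq> e}"
proof (rule finite_subset)
  show "{f \<in> E. u \<in> f \<and> f \<noteq> e} \<subseteq> {f \<in> E. u \<in> f}" by auto
  show "finite {f \<in> E. u \<in> f}" unfolding edges_at using finite_nbrs by simp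
qed

lemma side_sum_wdeg:
  assumes "{u, v} \<in> E"
  shows "wdeg G x u = x {u, v} + side_sum G u {u, v} x"
proof -
  have inj: "inj_on (\<lambda>z. {u, z}) (nbrs G u)"
    by (auto simp: inj_on_def doubleton_eq_iff)
  have "wdeg G x u = sum x {f \<in> E. u \<in> f}"
    unfolding wdeg_def edges_at using inj by (simp add: sum.reindex)
  also have "{f \<in> E. u \<in> f} = insert {u, v} {f \<in> E. u \<in> f \<and> f \<noteq> {u, v}}"
    using assms by auto
  also have "sum x \<dots> = x {u, v} + side_sum G u {u, v} x"
    unfolding side_sum_def using finite_edges_at[of u "{u, v}"] by (subst sum.insert) auto
  finally show ?thesis .
qed

lemma side_sum_nonneg: "(\<And>e. e \<in> E \<Longrightarrow> 0 \<le> x e) \<Longrightarrow> 0 \<le> side_sum G u e x"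
  unfolding side_sum_def by (rule sum_nonneg) auto

lemma side_sum_mono: "(\<And>e. e \<in> E \<Longrightarrow> x e \<le> y e) \<Longrightarrow> side_sum G u e x \<le> side_sum G u e y"
  unfolding side_sum_def by (rule sum_mono) auto

lemma side_sum_scale: "side_sum G u e (\<lambda>e\<in>E. c * x e) = c * side_sum G u e x"
  unfolding side_sum_def by (simp add: sum_distrib_left)

lemma side_sum_ge_edge:
  assumes "\<And>e. e \<in> E \<Longrightarrow> 0 \<le> x e" "f \<in> E" "u \<in> f" "f \<noteq> e"
  shows "x f \<le> side_sum G u e x"
  unfolding side_sum_def
  by (rule member_le_sum) (use assms finite_edges_at in auto)

lemma side_sum_ge_two_edges:
  assumes "\<And>e. e \<in> E \<Longrightarrow> 0 \<le> x e" "f \<in> E" "u \<in> f" "f \<noteq> e" "g \<in> E" "u \<in> g" "g \<noteq> e" "f \<noteq> g"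
  shows "x f + x g \<le> side_sum G u e x"
proof -
  have "x f + x g = sum x {f, g}" using assms by simp
  also have "\<dots> \<le> side_sum G u e x"
    unfolding side_sum_def
    by (rule sum_mono2) (use assms finite_edges_at in auto)
  finally show ?thesis .
qed

lemma F_map_edge:
  assumes "{u, v} \<in> E"
  shows "F_map G x {u, v} = max 1 (sqrt (side_sum G u {u, v} x * side_sum G v {u, v} x))"
  using assms edge_neq[OF assms] by (simp add: F_map_def)

lemma F_map_mono:
  assumes "\<And>e. e \<in> E \<Longrightarrow> 0 \<le> x e" "\<And>e. e \<in> E \<Longrightarrow> x e \<le> y e" "e \<in> E"
  shows "F_map G x e \<le> F_map G y e"
proof -
  have "(\<Prod>u\<in>e. side_sum G u e x) \<le> (\<Prod>u\<in>e. side_sum G u e y)"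
    by (rule prod_mono) (use assms side_sum_mono[of x y] side_sum_nonneg[of x] in auto)
  then show ?thesis using assms(3) by (auto simp: F_map_def max_def intro: order_trans)
qed

lemma F_map_PiE: "F_map G x \<in> E \<rightarrow>\<^sub>E {1..}"
  by (auto simp: F_map_def)

lemma supersolution_ge_1: "supersolution G x \<Longrightarrow> e \<in> E \<Longrightarrow> 1 \<le> x e"
  by (auto simp: supersolution_def PiE_iff)

lemma fixed_point_supersolution: "F_fixed_point G x \<Longrightarrow> supersolution G x"
  by (simp add: F_fixed_point_def supersolution_def)

lemma supersolution_iff:
  "supersolution G x \<longleftrightarrow> x \<in> E \<rightarrow>\<^sub>E {1..} \<and>
     (\<forall>u v. {u, v} \<in> E \<longrightarrow> side_sum G u {u, v} x * side_sum G v {u, v} x \<le> (x {u, v})\<^sup>2)"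
proof -
  have "F_map G x {u, v} \<le> x {u, v} \<longleftrightarrow>
      side_sum G u {u, v} x * side_sum G v {u, v} x \<le> (x {u, v})\<^sup>2"
    if "x \<in> E \<rightarrow>\<^sub>E {1..}" "{u, v} \<in> E" for u v
  proof -
    have "1 \<le> x {u, v}" using that by (auto simp: PiE_iff)
    moreover have "sqrt (side_sum G u {u, v} x * side_sum G v {u, v} x) \<le> x {u, v} \<longleftrightarrow>
      side_sum G u {u, v} x * side_sum G v {u, v} x \<le> (x {u, v})\<^sup>2"
      using \<open>1 \<le> x {u, v}\<close> real_sqrt_le_iff[of _ "(x {u, v})\<^sup>2"] by simp
    ultimately show ?thesis using that by (simp add: F_map_edge)
  qed
  moreover have "(\<forall>e\<in>E. Q e) \<longleftrightarrow> (\<forall>u v. {u, v} \<in> E \<longrightarrow> Q {u, v})" for Q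
  proof safe
    fix e assume *: "\<forall>u v. {u, v} \<in> E \<longrightarrow> Q {u, v}" and "e \<in> E"
    obtain u v where "e = {u, v}" by (rule edge_cases[OF \<open>e \<in> E\<close>])
    then show "Q e" using * \<open>e \<in> E\<close> by simp
  qed simp
  ultimately show ?thesis
    unfolding supersolution_def by (simp cong: conj_cong)
qed

lemma supersolutionD:
  "supersolution G x \<Longrightarrow> {u, v} \<in> E \<Longrightarrow>
     side_sum G u {u, v} x * side_sum G v {u, v} x \<le> (x {u, v})\<^sup>2"
  by (simp add: supersolution_iff)

lemma fixed_point_iff:
  "F_fixed_point G x \<longleftrightarrow> x \<in> E \<rightarrow>\<^sub>E {1..} \<and>
     (\<forall>u v. {u, v} \<in> E \<longrightarrow> x {u, v} = max 1 (sqrt (side_sum G u {u, v} x * side_sum G v {u, v} x)))"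
proof -
  have "F_map G x = x \<longleftrightarrow> (\<forall>u v. {u, v} \<in> E \<longrightarrow> F_map G x {u, v} = x {u, v})"
    if "x \<in> E \<rightarrow>\<^sub>E {1..}"
  proof
    assume *: "\<forall>u v. {u, v} \<in> E \<longrightarrow> F_map G x {u, v} = x {u, v}"
    show "F_map G x = x"
      proof (rule PiE_ext[OF F_map_PiE that])
      fix e assume "e \<in> E"
      obtain u v where "e = {u, v}" by (rule edge_cases[OF \<open>e \<in> E\<close>])
      then show "F_map G x e = x e" using * \<open>e \<in> E\<close> by simp
    qed
  qed auto
  then show ?thesis
    unfolding F_fixed_point_def by (auto simp: F_map_edge)
qed

lemma fixed_point_eq:
  assumes "F_fixed_point G x" "{u, v} \<in> E" "x {u, v} > 1"
  shows "(x {u, v})\<^sup>2 = side_sum G u {u, v} x * side_sum G v {u, v} x"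
proof -
  let ?p = "side_sum G u {u, v} x * side_sum G v {u, v} x"
  have "x {u, v} = max 1 (sqrt ?p)"
    using assms unfolding fixed_point_iff by blast
  then have "x {u, v} = sqrt ?p" using assms(3) by (simp add: max_def split: if_splits)
  moreover from this have "?p > 0" using assms(3)
    by (metis order.strict_trans real_sqrt_gt_0_iff zero_less_one)
  ultimately show ?thesis by simp
qed

text \<open>Complements \<open>fixed_point_eq\<close> at edges of weight exactly 1: if both side
  sums are at least 1, so is their product, and the maximum is the square root in any case.\<close>

lemma fixed_point_eq_nonpendant:
  assumes "F_fixed_point G x" "{u, v} \<in> E" "1 \<le> side_sum G u {u, v} x" "1 \<le> side_sum G v {u, v} x"
  shows "(x {u, v})\<^sup>2 = side_sum G u {u, v} x * side_sum G v {u, v} x"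
proof -
  have "1 \<le> side_sum G u {u, v} x * side_sum G v {u, v} x"
    using mult_mono[OF assms(3,4)] assms(3) by simp
  moreover have "x {u, v} = max 1 (sqrt (side_sum G u {u, v} x * side_sum G v {u, v} x))"
    using assms unfolding fixed_point_iff by blast
  ultimately show ?thesis by (simp add: max_def)
qed

text \<open>Knaster-Tarski argument: the pointwise infimum of all supersolutions is the least fixed
  point, and monotonicity of \<open>F_map\<close> is the only property used of it.\<close>

lemma fixed_point_below_supersolution:
  assumes w: "supersolution G w"
  obtains x where "F_fixed_point G x" "\<And>e. e \<in> E \<Longrightarrow> x e \<le> w e"
proof -
  define A where "A = {y. supersolution G y}"
  define x where "x = (\<lambda>e\<in>E. INF y\<in>A. y e)"
  have ne: "A \<noteq> {}" using w by (auto simp: A_def)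
  have bdd: "bdd_below ((\<lambda>y. y e) ` A)" if "e \<in> E" for e
    using that supersolution_ge_1 by (intro bdd_belowI2[of _ 1]) (auto simp: A_def)
  have le: "x e \<le> y e" if "supersolution G y" "e \<in> E" for y e
    using that bdd by (auto simp: x_def A_def intro!: cINF_lower)
  have ge: "1 \<le> x e" if "e \<in> E" for e
    using that ne supersolution_ge_1 by (auto simp: x_def A_def intro!: cINF_greatest)
  have Fle: "F_map G x e \<le> x e" if "e \<in> E" for e
  proof -
    have "F_map G x e \<le> y e" if "y \<in> A" for y
    proof -
      have "F_map G x e \<le> F_map G y e"
        using \<open>e \<in> E\<close> ge le that by (intro F_map_mono) (auto simp: A_def intro: order_trans[OF zero_le_one])
      then show ?thesis using \<open>e \<in> E\<close> that by (auto simp: A_def supersolution_def intro: order_trans)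
    qed
    then show ?thesis using that ne by (auto simp: x_def intro!: cINF_greatest)
  qed
  \<comment> \<open>Applying \<open>F_map\<close> to \<open>F_map G x \<le> x\<close> puts
    \<open>F_map G x\<close> into the family whose infimum is \<open>x\<close>; this yields the
    reverse inequality.\<close>
  have "supersolution G (F_map G x)"
    unfolding supersolution_def
  proof (intro conjI ballI F_map_PiE)
    fix e assume "e \<in> E"
    then show "F_map G (F_map G x) e \<le> F_map G x e"
      using Fle F_map_PiE[of x]
      by (intro F_map_mono) (auto simp: PiE_iff intro: order_trans[OF zero_le_one])
  qed
  then have "x e \<le> F_map G x e" if "e \<in> E" for e
    using le that by blast
  then have "F_map G x e = x e" if "e \<in> E" for e
    using Fle that by (meson antisym)
  moreover have xP: "x \<in> E \<rightarrow>\<^sub>E {1..}" using ge by (auto simp: x_def)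
  ultimately have "F_map G x = x"
    using PiE_ext[OF F_map_PiE xP] by blast
  then show ?thesis
    using that[of x] xP le[OF w] by (auto simp: F_fixed_point_def)
qed

text \<open>Connectedness is given for vertices, while ratios and walks live on edges.\<close>

lemma edge_connected_induct:
  assumes "e0 \<in> E" "P e0" "f \<in> E"
    and step: "\<And>e f. e \<in> E \<Longrightarrow> f \<in> E \<Longrightarrow> P e \<Longrightarrow> e \<inter> f \<noteq> {} \<Longrightarrow> P f"
  shows "P f"
proof -
  obtain a b where ab: "e0 = {a, b}" by (rule edge_cases[OF assms(1)])
  \<comment> \<open>Quantifying over all edges at \<open>z\<close> lets the induction pass through
    the edge to the next vertex.\<close>
  have all: "\<forall>g\<in>E. z \<in> g \<longrightarrow> P g" if "(a, z) \<in> (adj_rel G)\<^sup>*" for z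
    using that
  proof (induction rule: rtrancl_induct)
    case base
    then show ?case using step assms(1,2) ab by blast
  next
    case (step y z)
    then have yz: "{y, z} \<in> E" by (simp add: adj_rel_def)
    then have "P {y, z}" using step.IH by blast
    then show ?case using assms(4)[OF yz] by blast
  qed
  obtain c d where cd: "f = {c, d}" by (rule edge_cases[OF assms(3)])
  have "a \<in> V" "c \<in> V" using edge_verts[of a b] edge_verts[of c d] ab cd assms(1,3) by simp_all
  then have "(a, c) \<in> (adj_rel G)\<^sup>*" using conn by (simp add: connected_graph_def)
  then show ?thesis using all[of c] cd assms(3) by simp
qed

end

section \<open>Non-backtracking walks\<close>

text \<open>By concavity a negative slope persists, so the sequence would fall at least linearly and
  drop below \<open>b\<close>.\<close>

lemma concave_bdd_below_imp_mono:
  fixes a :: "nat \<Rightarrow> real"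
  assumes conc: "\<And>i. a i + a (Suc (Suc i)) \<le> 2 * a (Suc i)" and bdd: "\<And>i. b \<le> a i"
  shows "a i \<le> a (Suc i)"
proof (rule ccontr)
  assume "\<not> a i \<le> a (Suc i)"
  define s where "s = a (Suc i) - a i"
  have "s < 0" using \<open>\<not> a i \<le> a (Suc i)\<close> by (simp add: s_def)
  have slope: "a (Suc (i + m)) - a (i + m) \<le> s" for m
  proof (induction m)
    case (Suc m)
    then show ?case using conc[of "i + m"] by simp
  qed (simp add: s_def)
  have lin: "a (i + m) \<le> a i + real m * s" for m
  proof (induction m)
    case (Suc m)
    then show ?case using slope[of m] by (simp add: algebra_simps)
  qed simp
  obtain m where "real m * (- s) > a i - b"
    using reals_Archimedean3[of "- s"] \<open>s < 0\<close> by auto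
  then show False using lin[of m] bdd[of "i + m"] by (simp add: algebra_simps)
qed

lemma concave_bounded_slope_tendsto_0:
  fixes a :: "nat \<Rightarrow> real"
  assumes conc: "\<And>i. a i + a (Suc (Suc i)) \<le> 2 * a (Suc i)"
    and bdd: "\<And>i. b \<le> a i" "\<And>i. a i \<le> c"
  shows "(\<lambda>i. a (Suc i) - a i) \<longlonglongrightarrow> 0"
proof -
  have "incseq a" by (rule incseq_SucI) (rule concave_bdd_below_imp_mono[of a, OF conc bdd(1)])
  then obtain L where "a \<longlonglongrightarrow> L"
    using incseq_convergent[of a c] bdd(2) by blast
  then have "(\<lambda>i. a (Suc i) - a i) \<longlonglongrightarrow> L - L"
    by (intro tendsto_diff LIMSEQ_Suc)
  then show ?thesis by simp
qed

definition walk_edge :: "(nat \<Rightarrow> 'a) \<Rightarrow> nat \<Rightarrow> 'a set" where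
  "walk_edge v i = {v i, v (Suc i)}"

context lf_graph
begin

text \<open>The vertex between the edges \<open>i\<close> and \<open>Suc i\<close> has no third
  edge. The index is that of the edge entering the vertex, so the vertex concerned is
  \<open>v (Suc i)\<close>.\<close>

definition no_branch :: "(nat \<Rightarrow> 'a) \<Rightarrow> nat \<Rightarrow> bool" where
  "no_branch v i \<longleftrightarrow> {f \<in> E. v (Suc i) \<in> f} = {walk_edge v i, walk_edge v (Suc i)}"

lemma walk_edge_in: "nonbacktracking G v \<Longrightarrow> walk_edge v i \<in> E"
  by (simp add: nonbacktracking_def walk_edge_def)

lemma walk_edge_neq: "nonbacktracking G v \<Longrightarrow> walk_edge v i \<noteq> walk_edge v (Suc i)"
  by (simp add: nonbacktracking_def walk_edge_def doubleton_eq_iff) metis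

lemma walk_side_sum_ge:
  assumes "nonbacktracking G v" "\<And>e. e \<in> E \<Longrightarrow> 0 \<le> x e"
  shows "x (walk_edge v (Suc i)) \<le> side_sum G (v (Suc i)) (walk_edge v i) x"
    and "x (walk_edge v i) \<le> side_sum G (v (Suc i)) (walk_edge v (Suc i)) x"
  using walk_edge_in[OF assms(1)] walk_edge_neq[OF assms(1), of i] assms(2)
  by (auto intro!: side_sum_ge_edge simp: walk_edge_def[of v])

lemma walk_side_sum_ge_1:
  assumes "nonbacktracking G v" "\<And>e. e \<in> E \<Longrightarrow> 1 \<le> x e"
  shows "1 \<le> side_sum G (v (Suc i)) (walk_edge v i) x"
    and "1 \<le> side_sum G (v (Suc i)) (walk_edge v (Suc i)) x"
proof -
  have nn: "0 \<le> x e" if "e \<in> E" for e using assms(2)[OF that] by simp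
  show "1 \<le> side_sum G (v (Suc i)) (walk_edge v i) x"
    "1 \<le> side_sum G (v (Suc i)) (walk_edge v (Suc i)) x"
    using walk_side_sum_ge[where x = x, OF assms(1) nn] assms(2)[OF walk_edge_in[OF assms(1)]]
    by (meson order_trans)+
qed

lemma no_branch_side_sum:
  assumes "nonbacktracking G v" "no_branch v i"
  shows "side_sum G (v (Suc i)) (walk_edge v (Suc i)) x = x (walk_edge v i)"
    and "side_sum G (v (Suc i)) (walk_edge v i) x = x (walk_edge v (Suc i))"
proof -
  have "{f \<in> E. v (Suc i) \<in> f \<and> f \<noteq> walk_edge v (Suc i)} = {walk_edge v i}"
    "{f \<in> E. v (Suc i) \<in> f \<and> f \<noteq> walk_edge v i} = {walk_edge v (Suc i)}"
    using assms(2) walk_edge_neq[OF assms(1), of i] unfolding no_branch_def by auto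
  then show "side_sum G (v (Suc i)) (walk_edge v (Suc i)) x = x (walk_edge v i)"
    and "side_sum G (v (Suc i)) (walk_edge v i) x = x (walk_edge v (Suc i))"
    by (simp_all add: side_sum_def)
qed

lemma supersolution_walk:
  assumes "supersolution G x" "nonbacktracking G v"
  shows "side_sum G (v (Suc i)) (walk_edge v (Suc i)) x *
      side_sum G (v (Suc (Suc i))) (walk_edge v (Suc i)) x \<le> (x (walk_edge v (Suc i)))\<^sup>2"
  using supersolutionD[OF assms(1), of "v (Suc i)" "v (Suc (Suc i))"] walk_edge_in[OF assms(2), of "Suc i"]
  by (simp add: walk_edge_def)

text \<open>The two side sums at the middle edge contain the preceding and the following walk edge,
  so the product of these weights is at most the square of the middle one.\<close>

lemma supersolution_log_concave:
  assumes x: "supersolution G x" and v: "nonbacktracking G v"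
  shows "ln (x (walk_edge v i)) + ln (x (walk_edge v (Suc (Suc i)))) \<le> 2 * ln (x (walk_edge v (Suc i)))"
proof -
  have ge1: "1 \<le> x (walk_edge v j)" for j
    using supersolution_ge_1[OF x walk_edge_in[OF v]] .
  have nn: "0 \<le> x e" if "e \<in> E" for e using supersolution_ge_1[OF x that] by simp
  have "x (walk_edge v i) * x (walk_edge v (Suc (Suc i))) \<le> (x (walk_edge v (Suc i)))\<^sup>2"
    using walk_side_sum_ge(2)[where x = x, OF v nn, of i] walk_side_sum_ge(1)[where x = x, OF v nn, of "Suc i"]
      supersolution_walk[OF x v, of i] ge1
    by (smt (verit) mult_mono)
  then have "ln (x (walk_edge v i) * x (walk_edge v (Suc (Suc i)))) \<le> ln ((x (walk_edge v (Suc i)))\<^sup>2)"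
    using ge1[of i] ge1[of "Suc i"] ge1[of "Suc (Suc i)"] by (intro ln_mono) auto
  then show ?thesis
    using ge1[of i] ge1[of "Suc i"] ge1[of "Suc (Suc i)"]
    by (simp add: ln_mult ln_realpow)
qed

lemma supersolution_walk_ln:
  assumes x: "supersolution G x" "bdd_above (x ` E)" and v: "nonbacktracking G v"
  shows "ln (x (walk_edge v i)) \<le> ln (x (walk_edge v (Suc i)))"
    and "(\<lambda>i. ln (x (walk_edge v (Suc i))) - ln (x (walk_edge v i))) \<longlonglongrightarrow> 0"
proof -
  obtain B where B: "\<And>e. e \<in> E \<Longrightarrow> x e \<le> B" using x(2) by (auto simp: bdd_above_def)
  have ge1: "1 \<le> x (walk_edge v j)" for j
    using supersolution_ge_1[OF x(1) walk_edge_in[OF v]] .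
  have bdd: "0 \<le> ln (x (walk_edge v i))" "ln (x (walk_edge v i)) \<le> ln B" for i
    using ge1[of i] B[OF walk_edge_in[OF v], of i] by (auto intro!: ln_mono)
  note * = supersolution_log_concave[OF x(1) v]
  show "ln (x (walk_edge v i)) \<le> ln (x (walk_edge v (Suc i)))"
    using * bdd(1) by (rule concave_bdd_below_imp_mono)
  show "(\<lambda>i. ln (x (walk_edge v (Suc i))) - ln (x (walk_edge v i))) \<longlonglongrightarrow> 0"
    using * bdd by (rule concave_bounded_slope_tendsto_0)
qed

lemma supersolution_walk_mono:
  assumes x: "supersolution G x" "bdd_above (x ` E)" and v: "nonbacktracking G v" and "i \<le> j"
  shows "x (walk_edge v i) \<le> x (walk_edge v j)"
proof -
  have ge1: "1 \<le> x (walk_edge v j)" for j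
    using supersolution_ge_1[OF x(1) walk_edge_in[OF v]] .
  have "x (walk_edge v i) \<le> x (walk_edge v (Suc i))" for i
    using supersolution_walk_ln(1)[OF x v, of i] ge1[of i] ge1[of "Suc i"] by simp
  then have "incseq (\<lambda>i. x (walk_edge v i))" by (rule incseq_SucI)
  then show ?thesis using \<open>i \<le> j\<close> by (rule incseqD)
qed

text \<open>A branch at the walk bends the concave sequence of logarithms by a fixed amount, whereas its
  slopes tend to zero.\<close>

lemma eventually_no_branch:
  assumes x: "supersolution G x" "bdd_above (x ` E)" and v: "nonbacktracking G v"
  shows "eventually (no_branch v) sequentially"
proof -
  obtain B where B: "\<And>e. e \<in> E \<Longrightarrow> x e \<le> B" using x(2) by (auto simp: bdd_above_def)
  have ge1: "1 \<le> x (walk_edge v j)" for j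
    using supersolution_ge_1[OF x(1) walk_edge_in[OF v]] .
  have nn: "0 \<le> x e" if "e \<in> E" for e using supersolution_ge_1[OF x(1) that] by simp
  define s where "s i = ln (x (walk_edge v (Suc i))) - ln (x (walk_edge v i))" for i
  have s0: "s \<longlonglongrightarrow> 0" "0 \<le> s i" for i
    using supersolution_walk_ln[OF x v] by (simp_all add: s_def[abs_def])
  have "1 \<le> B" using B[OF walk_edge_in[OF v], of 0] ge1[of 0] by simp
  \<comment> \<open>A third edge weighs at least 1 and the walk edge at most \<open>B\<close>, so a
    branch enlarges the side sum by a factor of at least \<open>1 + 1 / B\<close>.\<close>
  then have "0 < ln (1 + 1 / B)" by (intro ln_gt_zero) simp
  with s0(1) have "eventually (\<lambda>i. s i < ln (1 + 1 / B)) sequentially"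
    by (rule order_tendstoD)
  then show ?thesis
  proof eventually_elim
    case (elim i)
    show ?case
    proof (rule ccontr)
      assume "\<not> no_branch v i"
      then obtain f where f: "f \<in> E" "v (Suc i) \<in> f" "f \<noteq> walk_edge v i" "f \<noteq> walk_edge v (Suc i)"
        using walk_edge_in[OF v, of i] walk_edge_in[OF v, of "Suc i"]
        by (auto simp: no_branch_def walk_edge_def)
      let ?a = "x (walk_edge v i)" and ?b = "x (walk_edge v (Suc i))" and ?c = "x (walk_edge v (Suc (Suc i)))"
      have "?a + x f \<le> side_sum G (v (Suc i)) (walk_edge v (Suc i)) x"
        using f walk_edge_in[OF v, of i] walk_edge_neq[OF v, of i] nn
        by (intro side_sum_ge_two_edges) (auto simp: walk_edge_def)
      moreover have "?a / B \<le> 1" using B[OF walk_edge_in[OF v], of i] \<open>1 \<le> B\<close> by simp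
      moreover have "1 \<le> x f" using supersolution_ge_1[OF x(1) f(1)] .
      ultimately have "?a * (1 + 1 / B) \<le> side_sum G (v (Suc i)) (walk_edge v (Suc i)) x"
        by (simp add: distrib_left)
      moreover have "?c \<le> side_sum G (v (Suc (Suc i))) (walk_edge v (Suc i)) x"
        using walk_side_sum_ge(1)[where x = x, OF v nn] .
      moreover have "0 \<le> ?a * (1 + 1 / B)" "0 \<le> ?c"
        using ge1[of i] ge1[of "Suc (Suc i)"] \<open>1 \<le> B\<close> by simp_all
      ultimately have "?a * (1 + 1 / B) * ?c \<le> side_sum G (v (Suc i)) (walk_edge v (Suc i)) x *
          side_sum G (v (Suc (Suc i))) (walk_edge v (Suc i)) x"
        by (intro mult_mono) linarith+
      also have "\<dots> \<le> ?b\<^sup>2" by (rule supersolution_walk[OF x(1) v])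
      finally have "?a * (1 + 1 / B) * ?c \<le> ?b\<^sup>2" .
      moreover have pos: "0 < ?a" "0 < ?b" "0 < ?c" "0 < 1 + 1 / B"
        using ge1[of i] ge1[of "Suc i"] ge1[of "Suc (Suc i)"] \<open>1 \<le> B\<close> by (auto intro: add_pos_nonneg)
      ultimately have "ln (?a * (1 + 1 / B) * ?c) \<le> ln (?b\<^sup>2)"
        by (intro ln_mono) auto
      then have "ln ?a + ln (1 + 1 / B) + ln ?c \<le> 2 * ln ?b"
        using pos by (simp add: ln_mult ln_realpow del: ln_le_cancel_iff)
      \<comment> \<open>The inequality reads \<open>s (Suc i) + ln (1 + 1 / B) \<le> s i\<close>,
        while \<open>s (Suc i)\<close> is nonnegative.\<close>
      then show False using elim s0(2)[of "Suc i"] by (simp add: s_def)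
    qed
  qed
qed

end

section \<open>Existence and merging of infinite non-backtracking walks\<close>

text \<open>\<open>z\<close> lies in the branch behind \<open>v\<close> as seen from
  \<open>u\<close>. Walks grow at the front, so a branch splits by inversion into \<open>v\<close>
  and the branches behind the further neighbours of \<open>v\<close>.\<close>

inductive nb_reach :: "'a sgraph \<Rightarrow> 'a \<Rightarrow> 'a \<Rightarrow> 'a \<Rightarrow> bool" for G where
  start: "{u, v} \<in> edges G \<Longrightarrow> nb_reach G u v v"
| step: "nb_reach G v w z \<Longrightarrow> {u, v} \<in> edges G \<Longrightarrow> w \<noteq> u \<Longrightarrow> nb_reach G u v z"

context lf_graph
begin

text \<open>Dependent choice on directed edges. It is used twice: for branches containing infinitely
  many vertices and for dominant edges.\<close>

lemma nonbacktracking_walk_choice: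
  assumes "R u v" and step: "\<And>u v. R u v \<Longrightarrow> {u, v} \<in> E \<and> (\<exists>w. R v w \<and> w \<noteq> u)"
  obtains p where "nonbacktracking G p" "p 0 = u" "p (Suc 0) = v" "\<And>i. R (p i) (p (Suc i))"
proof -
  \<comment> \<open>\<open>dependent_nat_choice\<close> does not prescribe the first state, so the
    start is part of the invariant.\<close>
  have "\<exists>f. \<forall>n. (R (fst (f n)) (snd (f n)) \<and> (n = 0 \<longrightarrow> f n = (u, v))) \<and>
      (fst (f (Suc n)) = snd (f n) \<and> snd (f (Suc n)) \<noteq> fst (f n))"
  proof (rule dependent_nat_choice)
    show "\<exists>x. R (fst x) (snd x) \<and> ((0::nat) = 0 \<longrightarrow> x = (u, v))"
      using assms(1) by auto
    fix x :: "'a \<times> 'a" and n :: nat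
    assume "R (fst x) (snd x) \<and> (n = 0 \<longrightarrow> x = (u, v))"
    then obtain w where "R (snd x) w" "w \<noteq> fst x" using step by blast
    then show "\<exists>y. (R (fst y) (snd y) \<and> (Suc n = 0 \<longrightarrow> y = (u, v))) \<and>
        fst y = snd x \<and> snd y \<noteq> fst x"
      by (intro exI[of _ "(snd x, w)"]) auto
  qed
  then obtain f where R: "\<And>n. R (fst (f n)) (snd (f n))" and f0: "f 0 = (u, v)"
    and next_f: "\<And>n. fst (f (Suc n)) = snd (f n)" "\<And>n. snd (f (Suc n)) \<noteq> fst (f n)"
    by auto
  let ?p = "\<lambda>n. fst (f n)"
  have Rp: "R (?p i) (?p (Suc i))" for i using R[of i] next_f(1)[of i] by simp
  have "nonbacktracking G ?p"
    unfolding nonbacktracking_def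
    using step[OF Rp] next_f by (metis (no_types, lifting))
  then show ?thesis using that[of ?p] Rp f0 next_f(1)[of 0] by simp
qed

text \<open>Koenig's lemma: by local finiteness an infinite branch continues in one of finitely many
  branches, of which one is again infinite.\<close>

lemma nonbacktracking_exists:
  assumes "infinite V"
  obtains v where "nonbacktracking G v"
proof -
  have reach: "z = y \<or> (\<exists>w. nb_reach G y w z)" if "(y, z) \<in> (adj_rel G)\<^sup>*" for y z
    using that
  proof (induction rule: converse_rtrancl_induct)
    case (step y y')
    then have yy': "{y, y'} \<in> E" by (simp add: adj_rel_def)
    from step.IH show ?case
    proof (elim disjE exE)
      assume "z = y'"
      then show ?thesis using nb_reach.start[OF yy'] by blast
    next
      fix w assume w: "nb_reach G y' w z"
      show ?thesis
      proof (cases "w = y")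
        case True
        \<comment> \<open>The walk would go from \<open>y\<close> to \<open>y'\<close> and straight
          back. Inverting the second step cancels the detour.\<close>
        with w have "nb_reach G y' y z" by simp
        then show ?thesis by cases auto
      next
        case False
        then show ?thesis using nb_reach.step[OF w yy'] by blast
      qed
    qed
  qed simp
  obtain v0 where v0: "v0 \<in> V" using conn by (auto simp: connected_graph_def)
  define R where "R u v \<longleftrightarrow> {u, v} \<in> E \<and> infinite {z. nb_reach G u v z}" for u v
  have edge: "{u, v} \<in> E" if "nb_reach G u v z" for u v z
    using that by cases auto
  have *: "V \<subseteq> insert v0 (\<Union>w\<in>nbrs G v0. {z. nb_reach G v0 w z})"
  proof
    fix z assume "z \<in> V"
    then have "(v0, z) \<in> (adj_rel G)\<^sup>*" using conn v0 by (simp add: connected_graph_def)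
    then show "z \<in> insert v0 (\<Union>w\<in>nbrs G v0. {z. nb_reach G v0 w z})"
      using reach[of v0 z] edge[of v0 _ z] by (auto simp: nbrs_def)
  qed
  have "\<not> finite (insert v0 (\<Union>w\<in>nbrs G v0. {z. nb_reach G v0 w z}))"
    using assms finite_subset[OF *] by blast
  then obtain w where "R v0 w"
    using finite_nbrs[of v0] by (auto simp: R_def nbrs_def)
  moreover have "{u, v} \<in> E \<and> (\<exists>w. R v w \<and> w \<noteq> u)" if uv: "R u v" for u v
  proof -
    have *: "{z. nb_reach G u v z} \<subseteq> insert v (\<Union>w\<in>nbrs G v - {u}. {z. nb_reach G v w z})"
    proof
      fix z assume "z \<in> {z. nb_reach G u v z}"
      then have "nb_reach G u v z" by simp
      then show "z \<in> insert v (\<Union>w\<in>nbrs G v - {u}. {z. nb_reach G v w z})"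
        by cases (use edge in \<open>auto simp: nbrs_def\<close>)
    qed
    have "\<not> finite (insert v (\<Union>w\<in>nbrs G v - {u}. {z. nb_reach G v w z}))"
      using uv finite_subset[OF *] by (simp only: R_def) blast
    then obtain w where "w \<in> nbrs G v - {u}" "infinite {z. nb_reach G v w z}"
      using finite_nbrs[of v] by auto
    then show ?thesis using uv by (auto simp: R_def nbrs_def)
  qed
  ultimately show ?thesis using nonbacktracking_walk_choice[of R v0 w] that by blast
qed

text \<open>Lets statements about the tail of one walk reach every edge. Passing to an adjacent
  edge, the walk is extended at its start, loses its first edge, or has its first vertex replaced;
  the tail survives up to a shift.\<close>

lemma walk_from_edge:
  assumes v: "nonbacktracking G v" and "f \<in> E"
  obtains p k m where "nonbacktracking G p" "walk_edge p 0 = f" "\<And>i. p (k + i) = v (m + i)"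
proof -
  define Q where "Q f \<longleftrightarrow> (\<exists>p k m. nonbacktracking G p \<and> walk_edge p 0 = f \<and> (\<forall>i. p (k + i) = v (m + i)))" for f
  have "Q f"
  proof (rule edge_connected_induct[where P = Q])
    show "walk_edge v 0 \<in> E" using v by (rule walk_edge_in)
    show "Q (walk_edge v 0)" using v unfolding Q_def by metis
    show "f \<in> E" by fact
    fix e f assume "e \<in> E" "f \<in> E" "Q e" "e \<inter> f \<noteq> {}"
    show "Q f"
    proof (cases "f = e")
      case False
      from \<open>Q e\<close> obtain p k m where p: "nonbacktracking G p" "walk_edge p 0 = e"
        and tail: "\<And>i. p (k + i) = v (m + i)" by (auto simp: Q_def)
      have "p 0 \<in> f \<or> p (Suc 0) \<in> f"
        using \<open>e \<inter> f \<noteq> {}\<close> p(2) by (auto simp: walk_edge_def)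
      then show ?thesis
      proof
        assume "p 0 \<in> f"
        then obtain c where c: "f = {p 0, c}" by (rule edge_obtain_other[OF \<open>f \<in> E\<close>])
        then have "c \<noteq> p (Suc 0)" using False p(2) by (auto simp: walk_edge_def)
        let ?q = "case_nat c p"
        have "nonbacktracking G ?q"
          using p(1) \<open>c \<noteq> p (Suc 0)\<close> c \<open>f \<in> E\<close>
          by (auto simp: nonbacktracking_def insert_commute split: nat.split)
        moreover have "walk_edge ?q 0 = f" using c by (auto simp: walk_edge_def)
        moreover have "?q (Suc k + i) = v (m + i)" for i using tail by simp
        ultimately show ?thesis unfolding Q_def by blast
      next
        assume "p (Suc 0) \<in> f"
        then obtain c where c: "f = {p (Suc 0), c}" by (rule edge_obtain_other[OF \<open>f \<in> E\<close>])
        show ?thesis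
        proof (cases "c = p (Suc (Suc 0))")
          case True
          let ?q = "\<lambda>i. p (Suc i)"
          have "nonbacktracking G ?q" using p(1) by (auto simp: nonbacktracking_def)
          moreover have "walk_edge ?q 0 = f" using c True by (auto simp: walk_edge_def)
          moreover have "?q (k + i) = v (Suc m + i)" for i using tail[of "Suc i"] by simp
          ultimately show ?thesis unfolding Q_def by blast
        next
          case False
          let ?q = "p(0 := c)"
          have "nonbacktracking G ?q"
            using p(1) False c \<open>f \<in> E\<close> by (auto simp: nonbacktracking_def insert_commute)
          moreover have "walk_edge ?q 0 = f" using c by (auto simp: walk_edge_def)
          moreover have "?q (Suc k + i) = v (Suc m + i)" for i using tail[of "Suc i"] by simp
          ultimately show ?thesis unfolding Q_def by blast
        qed
      qed
    qed (use \<open>Q e\<close> in simp)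
  qed
  then show ?thesis using that by (auto simp: Q_def)
qed

end

section \<open>Comparison of fixed points and supersolutions\<close>

context lf_graph
begin

lemma side_sum_le_ratio:
  assumes "\<And>f. f \<in> E \<Longrightarrow> u \<in> f \<Longrightarrow> f \<noteq> e \<Longrightarrow> x f \<le> m * y f"
  shows "side_sum G u e x \<le> m * side_sum G u e y"
  unfolding side_sum_def sum_distrib_left by (rule sum_mono) (use assms in auto)

text \<open>Equality case of \<open>side_sum_le_ratio\<close>: nonnegative slacks with nonpositive
  sum all vanish.\<close>

lemma side_sum_eq_ratio:
  assumes le: "\<And>f. f \<in> E \<Longrightarrow> u \<in> f \<Longrightarrow> f \<noteq> e \<Longrightarrow> x f \<le> m * y f"
    and eq: "m * side_sum G u e y \<le> side_sum G u e x"
    and f: "f \<in> E" "u \<in> f" "f \<noteq> e"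
  shows "x f = m * y f"
proof -
  let ?S = "{f \<in> E. u \<in> f \<and> f \<noteq> e}"
  have "(\<Sum>f\<in>?S. m * y f - x f) \<le> 0"
    using eq by (simp add: side_sum_def sum_subtractf sum_distrib_left)
  moreover have "0 \<le> (\<Sum>f\<in>?S. m * y f - x f)"
    by (rule sum_nonneg) (use le in auto)
  ultimately have "(\<Sum>f\<in>?S. m * y f - x f) = 0" by simp
  then have "\<forall>f\<in>?S. m * y f - x f = 0"
    using finite_edges_at le by (subst (asm) sum_nonneg_eq_0_iff) auto
  then show ?thesis using f by simp
qed

end

text \<open>The maximum principle: a non-backtracking walk of locally maximal ratios \<open>x e / y e\<close> is forced to
  have constant ratio, because the slopes of \<open>ln \<circ> x\<close> and \<open>ln \<circ> y\<close> along it tend to zero.\<close>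

locale fp_vs_supersolution = lf_graph +
  fixes x y :: "'a set \<Rightarrow> real"
  assumes x_fp: "F_fixed_point G x" and x_bdd: "bdd_above (x ` E)"
    and y_super: "supersolution G y" and y_bdd: "bdd_above (y ` E)"
begin

definition r :: "'a set \<Rightarrow> real" where "r e = x e / y e"

lemma x_super: "supersolution G x"
  using x_fp by (rule fixed_point_supersolution)

lemma ge_1: "e \<in> E \<Longrightarrow> 1 \<le> x e" "e \<in> E \<Longrightarrow> 1 \<le> y e"
  using supersolution_ge_1 x_super y_super by auto

lemma x_eq_r: "e \<in> E \<Longrightarrow> x e = r e * y e"
  using ge_1(2)[of e] by (simp add: r_def)

lemma r_pos: "e \<in> E \<Longrightarrow> 0 < r e"
  using ge_1[of e] by (simp add: r_def)

lemma le_ratio: "f \<in> E \<Longrightarrow> r f \<le> m \<Longrightarrow> x f \<le> m * y f"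
  using ge_1(2)[of f] by (simp add: x_eq_r)

text \<open>Since \<open>y\<close> is at least 1, a ratio above 1 forces \<open>x\<close> above 1,
  where the cutoff in \<open>F_map\<close> is inactive.\<close>

lemma x_eq:
  assumes "{u, v} \<in> E" "1 < r {u, v}"
  shows "(x {u, v})\<^sup>2 = side_sum G u {u, v} x * side_sum G v {u, v} x"
proof -
  have "1 < r {u, v} * y {u, v}"
    using assms(2) ge_1(2)[OF assms(1)] by (smt (verit) mult_le_cancel_left1)
  then have "1 < x {u, v}" using x_eq_r[OF assms(1)] by simp
  then show ?thesis using x_fp assms(1) by (intro fixed_point_eq)
qed

lemma side_nonneg: "0 \<le> side_sum G u e x" "0 \<le> side_sum G u e y"
  using side_sum_nonneg[of x] side_sum_nonneg[of y] ge_1 by (meson order_trans zero_le_one)+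

text \<open>An edge with ratio above 1 has a further edge at either end, so a walk through it can
  continue.\<close>

lemma side_pos:
  assumes "{u, v} \<in> E" "1 < r {u, v}"
  shows "0 < side_sum G u {u, v} x" "0 < side_sum G v {u, v} x"
proof -
  have "0 < (x {u, v})\<^sup>2" using ge_1(1)[OF assms(1)] by simp
  then have "0 < side_sum G u {u, v} x * side_sum G v {u, v} x" using x_eq[OF assms] by simp
  then show "0 < side_sum G u {u, v} x" "0 < side_sum G v {u, v} x"
    using side_nonneg by (auto simp: zero_less_mult_iff dest: order.strict_trans1)
qed

lemma max_ratio_at:
  assumes uv: "{u, v} \<in> E" "1 < r {u, v}"
  obtains f where "f \<in> E" "v \<in> f" "f \<noteq> {u, v}"
    "\<forall>g\<in>E. v \<in> g \<and> g \<noteq> {u, v} \<longrightarrow> r g \<le> r f"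
proof -
  let ?S = "{f \<in> E. v \<in> f \<and> f \<noteq> {u, v}}"
  have "?S \<noteq> {}"
  proof
    assume "?S = {}"
    then have "side_sum G v {u, v} x = 0" by (simp only: side_sum_def sum.empty)
    then show False using side_pos(2)[OF uv] by simp
  qed
  then have "Max (r ` ?S) \<in> r ` ?S"
    using finite_edges_at[of v "{u, v}"] by (intro Max_in) auto
  then obtain f where f: "f \<in> ?S" "Max (r ` ?S) = r f" by auto
  have "r g \<le> r f" if "g \<in> ?S" for g
    using Max_ge[of "r ` ?S" "r g"] finite_edges_at[of v "{u, v}"] that f(2) by auto
  then show ?thesis using that[of f] f(1) by auto
qed

text \<open>Combines the equation for \<open>x\<close> with the inequality for \<open>y\<close>: the
  ratio is at most the geometric mean of the bounds on the two sides.\<close>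

lemma ratio_step:
  assumes uv: "{u, v} \<in> E" "1 < r {u, v}"
    and m: "\<And>g. g \<in> E \<Longrightarrow> u \<in> g \<Longrightarrow> g \<noteq> {u, v} \<Longrightarrow> r g \<le> m"
    and n: "\<And>g. g \<in> E \<Longrightarrow> v \<in> g \<Longrightarrow> g \<noteq> {u, v} \<Longrightarrow> r g \<le> n"
  shows "(r {u, v})\<^sup>2 \<le> m * n"
proof -
  let ?A = "side_sum G u {u, v}" and ?B = "side_sum G v {u, v}"
  obtain g where "g \<in> E" "u \<in> g" "g \<noteq> {u, v}"
    using max_ratio_at[of v u] uv by (metis insert_commute)
  then have "0 < m" using m r_pos less_le_trans by blast
  obtain g where "g \<in> E" "v \<in> g" "g \<noteq> {u, v}" using max_ratio_at[OF uv] by metis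
  then have "0 < n" using n r_pos less_le_trans by blast
  have "?A x \<le> m * ?A y" "?B x \<le> n * ?B y"
    using m n le_ratio by (auto intro!: side_sum_le_ratio)
  then have "(x {u, v})\<^sup>2 \<le> (m * ?A y) * (n * ?B y)"
    unfolding x_eq[OF uv] using side_nonneg \<open>0 < m\<close> by (intro mult_mono) auto
  also have "\<dots> = (m * n) * (?A y * ?B y)" by simp
  also have "\<dots> \<le> (m * n) * (y {u, v})\<^sup>2"
    using supersolutionD[OF y_super uv(1)] \<open>0 < m\<close> \<open>0 < n\<close> by (intro mult_left_mono) auto
  finally have "(r {u, v})\<^sup>2 * (y {u, v})\<^sup>2 \<le> (m * n) * (y {u, v})\<^sup>2"
    using x_eq_r[OF uv(1)] by (simp add: power_mult_distrib)
  moreover have "0 < (y {u, v})\<^sup>2" using ge_1(2)[OF uv(1)] by simp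
  ultimately show ?thesis by (rule mult_right_le_imp_le)
qed

text \<open>A ratio that is maximal at both ends turns the estimate of \<open>ratio_step\<close>
  into an equality, and so term by term in the side sum at \<open>u\<close>.\<close>

lemma ratio_equality:
  assumes uv: "{u, v} \<in> E" "1 < r {u, v}"
    and m: "\<And>g. g \<in> E \<Longrightarrow> u \<in> g \<Longrightarrow> r g \<le> r {u, v}"
    and n: "\<And>g. g \<in> E \<Longrightarrow> v \<in> g \<Longrightarrow> r g \<le> r {u, v}"
    and f: "f \<in> E" "u \<in> f"
  shows "r f = r {u, v}"
proof (cases "f = {u, v}")
  case False
  let ?A = "side_sum G u {u, v}" and ?B = "side_sum G v {u, v}" and ?r = "r {u, v}"
  have leA: "x g \<le> ?r * y g" if "g \<in> E" "u \<in> g" "g \<noteq> {u, v}" for g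
    using m le_ratio that by auto
  have B: "?B x \<le> ?r * ?B y"
    using n le_ratio by (auto intro!: side_sum_le_ratio)
  have "?r * ?A y * ?B x \<le> ?r * ?A y * (?r * ?B y)"
    using B side_nonneg(2)[of u "{u, v}"] uv(2) by (intro mult_left_mono) auto
  also have "\<dots> = ?r\<^sup>2 * (?A y * ?B y)" by (simp add: power2_eq_square)
  also have "\<dots> \<le> ?r\<^sup>2 * (y {u, v})\<^sup>2"
    using supersolutionD[OF y_super uv(1)] by (intro mult_left_mono) auto
  also have "\<dots> = (x {u, v})\<^sup>2"
    using x_eq_r[OF uv(1)] by (simp add: power_mult_distrib)
  also have "\<dots> = ?A x * ?B x" by (rule x_eq[OF uv])
  \<comment> \<open>The positive factor \<open>?B x\<close> is cancelled; positivity comes from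
    \<open>side_pos\<close>.\<close>
  finally have "?r * ?A y \<le> ?A x" using side_pos(2)[OF uv] by (rule mult_right_le_imp_le)
  with leA have "x f = ?r * y f"
    using f False by (rule side_sum_eq_ratio)
  then show ?thesis using ge_1(2)[OF f(1)] by (simp add: r_def)
qed simp

text \<open>Maximality is required only at the tail \<open>u\<close> of the directed edge, which is
  what a walk arriving from behind can guarantee.\<close>

definition dominant :: "'a \<Rightarrow> 'a \<Rightarrow> bool" where
  "dominant u v \<longleftrightarrow> {u, v} \<in> E \<and> 1 < r {u, v} \<and> (\<forall>f\<in>E. u \<in> f \<longrightarrow> r f \<le> r {u, v})"

text \<open>With the bound \<open>r {u, v}\<close> on the side of \<open>u\<close>,
  \<open>ratio_step\<close> leaves a largest ratio at \<open>v\<close> of at least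
  \<open>r {u, v}\<close>; that edge dominates next.\<close>

lemma dominant_step:
  assumes "dominant u v"
  shows "\<exists>w. dominant v w \<and> w \<noteq> u"
proof -
  have uv: "{u, v} \<in> E" "1 < r {u, v}" and near: "\<And>f. f \<in> E \<Longrightarrow> u \<in> f \<Longrightarrow> r f \<le> r {u, v}"
    using assms by (auto simp: dominant_def)
  obtain f where f: "f \<in> E" "v \<in> f" "f \<noteq> {u, v}"
    and max: "\<forall>g\<in>E. v \<in> g \<and> g \<noteq> {u, v} \<longrightarrow> r g \<le> r f"
    by (rule max_ratio_at[OF uv])
  have "(r {u, v})\<^sup>2 \<le> r {u, v} * r f"
    using near max by (intro ratio_step[OF uv]) auto
  then have "r {u, v} \<le> r f" using uv(2) by (simp add: power2_eq_square)
  obtain w where w: "f = {v, w}" by (rule edge_obtain_other[OF f(1,2)])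
  have "dominant v w"
    unfolding dominant_def using w f(1) uv(2) \<open>r {u, v} \<le> r f\<close> max by force
  moreover have "w \<noteq> u" using f(3) w by (auto simp: insert_commute)
  ultimately show ?thesis by blast
qed

text \<open>Along a dominant walk the slopes \<open>d\<close> of the logarithmic ratio are
  nonnegative and tend to zero. Beyond the last branching they are also nondecreasing, hence zero
  there, and equality travels back to the start.\<close>

lemma dominant_constant:
  assumes "dominant u v" "f \<in> E" "u \<in> f"
  shows "r f = r {u, v}"
proof -
  have "\<And>u v. dominant u v \<Longrightarrow> {u, v} \<in> E \<and> (\<exists>w. dominant v w \<and> w \<noteq> u)"
    using dominant_step by (auto simp: dominant_def)
  with assms(1) obtain p where p: "nonbacktracking G p" "p 0 = u" "p (Suc 0) = v"
    and dominant: "\<And>i. dominant (p i) (p (Suc i))"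
    using nonbacktracking_walk_choice[of dominant u v] by blast
  let ?e = "walk_edge p"
  have eE: "?e i \<in> E" for i by (rule walk_edge_in[OF p(1)])
  have gt1: "1 < r (?e i)" for i using dominant[of i] by (simp add: dominant_def walk_edge_def)
  have near: "r g \<le> r (?e i)" if "g \<in> E" "p i \<in> g" for g i
    using dominant[of i] that by (simp add: dominant_def walk_edge_def)
  have mono: "r (?e i) \<le> r (?e (Suc i))" for i
    using near[OF eE, of "Suc i" i] by (simp add: walk_edge_def)
  define d where "d i = ln (r (?e (Suc i))) - ln (r (?e i))" for i
  have ln_r: "ln (r (?e i)) = ln (x (?e i)) - ln (y (?e i))" for i
    using ge_1[OF eE, of i] by (simp add: r_def ln_div)
  have "(\<lambda>i. (ln (x (?e (Suc i))) - ln (x (?e i))) - (ln (y (?e (Suc i))) - ln (y (?e i)))) \<longlonglongrightarrow> 0 - 0"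
    by (intro tendsto_diff supersolution_walk_ln(2) x_super y_super x_bdd y_bdd p(1))
  then have "d \<longlonglongrightarrow> 0" by (simp add: d_def[abs_def] ln_r algebra_simps)
  have d_nonneg: "0 \<le> d i" for i using mono[of i] gt1[of i] gt1[of "Suc i"] by (simp add: d_def)
  obtain N where N: "\<And>i. N \<le> i \<Longrightarrow> no_branch p i"
    using eventually_no_branch[OF x_super x_bdd p(1)] by (auto simp: eventually_sequentially)
  \<comment> \<open>Without a branch, \<open>?e i\<close> is the only other edge behind
    \<open>?e (Suc i)\<close>, so \<open>ratio_step\<close> becomes convexity of the logarithmic
    ratio.\<close>
  have d_mono: "d i \<le> d (Suc i)" if "N \<le> i" for i
  proof -
    have prev: "r g \<le> r (?e i)" if "g \<in> E" "p (Suc i) \<in> g" "g \<noteq> {p (Suc i), p (Suc (Suc i))}" for g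
    proof -
      have "g \<in> {f \<in> E. p (Suc i) \<in> f}" using that by simp
      then have "g \<in> {?e i, ?e (Suc i)}" using N[OF \<open>N \<le> i\<close>] by (simp only: no_branch_def)
      then have "g = ?e i" using that(3) by (simp add: walk_edge_def)
      then show ?thesis by simp
    qed
    have "(r {p (Suc i), p (Suc (Suc i))})\<^sup>2 \<le> r (?e i) * r (?e (Suc (Suc i)))"
      using eE[of "Suc i"] gt1[of "Suc i"]
      by (intro ratio_step prev near) (simp_all add: walk_edge_def)
    then have "ln ((r (?e (Suc i)))\<^sup>2) \<le> ln (r (?e i) * r (?e (Suc (Suc i))))"
      using gt1[of "Suc i"] by (intro ln_mono) (auto simp: walk_edge_def)
    then show ?thesis
      using gt1[of i] gt1[of "Suc i"] gt1[of "Suc (Suc i)"]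
      by (simp add: d_def ln_mult ln_realpow del: ln_le_cancel_iff)
  qed
  have "d N = 0"
  proof -
    have "incseq (\<lambda>i. d (i + N))" using d_mono by (intro incseq_SucI) simp
    moreover have "(\<lambda>i. d (i + N)) \<longlonglongrightarrow> 0" using \<open>d \<longlonglongrightarrow> 0\<close> by (rule LIMSEQ_ignore_initial_segment)
    ultimately have "d (0 + N) \<le> 0" by (rule incseq_le)
    then show ?thesis using d_nonneg[of N] by simp
  qed
  then have rN: "r (?e (Suc N)) = r (?e N)"
    using gt1[of N] gt1[of "Suc N"] by (simp add: d_def)
  \<comment> \<open>Equal ratios on two successive walk edges make the first one maximal at both of
    its ends.\<close>
  have all_eq: "\<forall>g\<in>E. p i \<in> g \<longrightarrow> r g = r (?e i)" if "r (?e (Suc i)) = r (?e i)" for i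
  proof (intro ballI impI)
    fix g assume g: "g \<in> E" "p i \<in> g"
    have "r g = r {p i, p (Suc i)}"
    proof (rule ratio_equality)
      show "{p i, p (Suc i)} \<in> E" "1 < r {p i, p (Suc i)}"
        using eE[of i] gt1[of i] by (simp_all add: walk_edge_def)
      show "r h \<le> r {p i, p (Suc i)}" if "h \<in> E" "p i \<in> h" for h
        using near[OF that] by (simp add: walk_edge_def)
      show "r h \<le> r {p i, p (Suc i)}" if h: "h \<in> E" "p (Suc i) \<in> h" for h
        using near[OF h] \<open>r (?e (Suc i)) = r (?e i)\<close> by (simp add: walk_edge_def)
    qed (use g in auto)
    then show "r g = r (?e i)" by (simp add: walk_edge_def)
  qed
  \<comment> \<open>Downward induction from \<open>N\<close>: \<open>?e n\<close> contains
    \<open>p (Suc n)\<close>, so constancy at that vertex gives the equality that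
    \<open>all_eq\<close> needs at \<open>n\<close>.\<close>
  have "\<forall>g\<in>E. p 0 \<in> g \<longrightarrow> r g = r (?e 0)"
  proof (rule inc_induct[of 0 N])
    show "\<forall>g\<in>E. p N \<in> g \<longrightarrow> r g = r (?e N)" by (rule all_eq[OF rN])
    show "\<forall>g\<in>E. p n \<in> g \<longrightarrow> r g = r (?e n)" if "\<forall>g\<in>E. p (Suc n) \<in> g \<longrightarrow> r g = r (?e (Suc n))" for n
      using that eE[of n] by (intro all_eq) (simp add: walk_edge_def)
  qed simp
  then show ?thesis using assms(2,3) p by (simp add: walk_edge_def)
qed

text \<open>The given edge need not be dominant in either direction. By the geometric-mean bound one
  of its ends carries an edge with at least the same ratio, and a dominant walk can leave through
  that end.\<close>

lemma ratio_adjacent: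
  assumes uv: "{u, v} \<in> E" "1 < r {u, v}" and f: "f \<in> E" "f \<inter> {u, v} \<noteq> {}"
  shows "r f = r {u, v}"
proof -
  have one_side: "r f = r {a, b}"
    if ab: "{a, b} \<in> E" "1 < r {a, b}" and g: "g \<in> E" "b \<in> g" "g \<noteq> {a, b}" "r {a, b} \<le> r g"
      "\<forall>h\<in>E. b \<in> h \<and> h \<noteq> {a, b} \<longrightarrow> r h \<le> r g" and f: "f \<in> E" "f \<inter> {a, b} \<noteq> {}" for a b f g
  proof -
    obtain w where w: "g = {b, w}" by (rule edge_obtain_other[OF g(1,2)])
    have "dominant b w" unfolding dominant_def using ab g w by force
    then have b: "r h = r {b, w}" if "h \<in> E" "b \<in> h" for h using dominant_constant that by blast
    then have "r {a, b} = r {b, w}" using ab(1) by blast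
    \<comment> \<open>Once all ratios at \<open>b\<close> agree, the reversed edge is dominant too,
      and a second walk leaves through \<open>a\<close>.\<close>
    then have "dominant b a" using ab b by (simp add: dominant_def insert_commute)
    then obtain z where "dominant a z" "z \<noteq> b" using dominant_step by blast
    then have a: "r h = r {a, z}" if "h \<in> E" "a \<in> h" for h using dominant_constant that by blast
    then have "r {a, b} = r {a, z}" using ab(1) by blast
    then show ?thesis using a b f \<open>r {a, b} = r {b, w}\<close> by auto
  qed
  have vu: "{v, u} \<in> E" "1 < r {v, u}" using uv by (simp_all add: insert_commute)
  obtain g where g: "g \<in> E" "v \<in> g" "g \<noteq> {u, v}"
    "\<forall>h\<in>E. v \<in> h \<and> h \<noteq> {u, v} \<longrightarrow> r h \<le> r g" by (rule max_ratio_at[OF uv])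
  obtain g' where g': "g' \<in> E" "u \<in> g'" "g' \<noteq> {v, u}"
    "\<forall>h\<in>E. u \<in> h \<and> h \<noteq> {v, u} \<longrightarrow> r h \<le> r g'" by (rule max_ratio_at[OF vu])
  have "(r {u, v})\<^sup>2 \<le> r g' * r g"
    using g(4) g'(4) by (intro ratio_step[OF uv]) (auto simp: insert_commute)
  then have "r {u, v} \<le> r g \<or> r {u, v} \<le> r g'"
    using r_pos[OF g(1)] r_pos[OF g'(1)] uv(2) unfolding power2_eq_square
    by (smt (verit) mult_strict_mono)
  then show ?thesis
  proof
    assume "r {u, v} \<le> r g"
    then show ?thesis using one_side[OF uv g(1-3) _ g(4) f] by blast
  next
    assume "r {u, v} \<le> r g'"
    then have "r {v, u} \<le> r g'" by (simp add: insert_commute)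
    moreover have "f \<inter> {v, u} \<noteq> {}" using f(2) by (simp add: insert_commute)
    ultimately have "r f = r {v, u}" using one_side[OF vu g'(1-3) _ g'(4) f(1)] by blast
    then show ?thesis by (simp add: insert_commute)
  qed
qed

text \<open>The second alternative is real: on a two-way infinite path every constant weight of at
  least 1 is a fixed point.\<close>

lemma dichotomy: "(\<forall>e\<in>E. x e \<le> y e) \<or> (\<exists>M>1. \<forall>e\<in>E. x e = M * y e)"
proof (rule disjCI)
  assume "\<not> (\<exists>M>1. \<forall>e\<in>E. x e = M * y e)"
  show "\<forall>e\<in>E. x e \<le> y e"
  proof (rule ccontr)
    assume "\<not> (\<forall>e\<in>E. x e \<le> y e)"
    then obtain e where e: "e \<in> E" "y e < x e" by auto
    then have gt1: "1 < r e" using ge_1(2)[OF e(1)] by (simp add: r_def)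
    have "r f = r e" if "f \<in> E" for f
    proof (rule edge_connected_induct[OF e(1), where P = "\<lambda>f. r f = r e"])
      fix g h assume *: "g \<in> E" "h \<in> E" "r g = r e" "g \<inter> h \<noteq> {}"
      obtain a b where ab: "g = {a, b}" by (rule edge_cases[OF *(1)])
      show "r h = r e" using ratio_adjacent[of a b h] * ab gt1 by auto
    qed (use that in auto)
    then have "\<forall>f\<in>E. x f = r e * y f" using x_eq_r by simp
    then show False using gt1 \<open>\<not> (\<exists>M>1. \<forall>e\<in>E. x e = M * y e)\<close> by blast
  qed
qed

end

section \<open>Uniqueness, normalization and rigidity; pendant edges\<close>

context lf_graph
begin

text \<open>A constant ratio \<open>M > 1\<close> would push the infimum of \<open>x\<close> up to
  at least \<open>M\<close>.\<close>

lemma bounded_normalized_fp_le_supersolution: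
  assumes x: "bounded_normalized_fp G x" and y: "supersolution G y" "bdd_above (y ` E)" and "e \<in> E"
  shows "x e \<le> y e"
proof -
  interpret fp_vs_supersolution G x y
    using x y by unfold_locales (auto simp: bounded_normalized_fp_def)
  have False if M: "M > 1" "\<forall>e\<in>E. x e = M * y e" for M
  proof -
    have "M \<le> x f" if "f \<in> E" for f
      using M ge_1(2)[OF that] that by simp
    then have "M \<le> (INF e\<in>E. x e)" using \<open>e \<in> E\<close> by (intro cINF_greatest) auto
    then show False using x M(1) by (simp add: bounded_normalized_fp_def)
  qed
  then show ?thesis using dichotomy \<open>e \<in> E\<close> by blast
qed

lemma bounded_normalized_fp_supersolution:
  assumes "bounded_normalized_fp G x"
  shows "supersolution G x" "bdd_above (x ` E)" "F_fixed_point G x"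
  using assms fixed_point_supersolution by (auto simp: bounded_normalized_fp_def)

lemma bounded_normalized_fp_unique:
  assumes x: "bounded_normalized_fp G x" and y: "bounded_normalized_fp G y"
  shows "x = y"
proof (rule PiE_ext)
  show "x \<in> E \<rightarrow>\<^sub>E {1..}" "y \<in> E \<rightarrow>\<^sub>E {1..}"
    using assms by (simp_all add: bounded_normalized_fp_def F_fixed_point_def)
  fix e assume "e \<in> E"
  show "x e = y e"
  proof (rule antisym)
    show "x e \<le> y e"
      using x bounded_normalized_fp_supersolution(1,2)[OF y] \<open>e \<in> E\<close>
      by (rule bounded_normalized_fp_le_supersolution)
    show "y e \<le> x e"
      using y bounded_normalized_fp_supersolution(1,2)[OF x] \<open>e \<in> E\<close>
      by (rule bounded_normalized_fp_le_supersolution)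
  qed
qed

lemma INF_ge_1:
  assumes "x \<in> E \<rightarrow>\<^sub>E {1..}" "E \<noteq> {}"
  shows "1 \<le> (INF e\<in>E. x e :: real)" "e \<in> E \<Longrightarrow> (INF e\<in>E. x e) \<le> x e"
proof -
  have x1: "1 \<le> x e" if "e \<in> E" for e using assms(1) that by (auto simp: PiE_iff)
  show "1 \<le> (INF e\<in>E. x e)" using assms(2) x1 by (rule cINF_greatest)
  show "e \<in> E \<Longrightarrow> (INF e\<in>E. x e) \<le> x e"
    using x1 by (intro cINF_lower) (auto intro!: bdd_belowI2[of _ 1])
qed

text \<open>\<open>F_map\<close> is not homogeneous because of the cutoff at 1. But if the infimum
  exceeds 1, the cutoff is inactive on every edge, and the remaining equation scales.\<close>

lemma fixed_point_normalize:
  assumes x: "F_fixed_point G x" "bdd_above (x ` E)" and ne: "E \<noteq> {}"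
  defines "c \<equiv> INF e\<in>E. x e"
  shows "bounded_normalized_fp G (\<lambda>e\<in>E. x e / c)"
proof -
  have xP: "x \<in> E \<rightarrow>\<^sub>E {1..}" using x(1) by (simp add: F_fixed_point_def)
  have c1: "1 \<le> c" and cle: "\<And>e. e \<in> E \<Longrightarrow> c \<le> x e"
    using INF_ge_1[OF xP ne] by (simp_all add: c_def)
  define z where "z = (\<lambda>e\<in>E. x e / c)"
  have z_scale: "z = (\<lambda>e\<in>E. (1 / c) * x e)" by (auto simp: z_def)
  have side: "side_sum G u e z = side_sum G u e x / c" for u e
    unfolding z_scale side_sum_scale by simp
  have "F_fixed_point G z"
  proof (cases "c = 1")
    case True
    then have "z = x" using xP by (auto simp: z_def PiE_iff extensional_def)
    then show ?thesis using x by simp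
  next
    case False
    show ?thesis
      unfolding fixed_point_iff
    proof (intro conjI allI impI)
      show "z \<in> E \<rightarrow>\<^sub>E {1..}" using c1 cle by (auto simp: z_def)
      fix u v assume uv: "{u, v} \<in> E"
      let ?p = "side_sum G u {u, v} x * side_sum G v {u, v} x"
      have "(x {u, v})\<^sup>2 = ?p"
        using fixed_point_eq[OF x(1) uv] cle[OF uv] c1 False by simp
      then have "side_sum G u {u, v} z * side_sum G v {u, v} z = (z {u, v})\<^sup>2"
        unfolding side using uv by (simp add: z_def power2_eq_square)
      moreover have "1 \<le> z {u, v}" using uv cle[OF uv] c1 by (simp add: z_def)
      ultimately show "z {u, v} = max 1 (sqrt (side_sum G u {u, v} z * side_sum G v {u, v} z))"
        by simp
    qed
  qed
  moreover have "bdd_above (z ` E)"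
  proof -
    obtain B where "\<And>e. e \<in> E \<Longrightarrow> x e \<le> B" using x(2) by (auto simp: bdd_above_def)
    then show ?thesis using c1 by (intro bdd_aboveI2[of _ _ "B / c"]) (auto simp: z_def divide_right_mono)
  qed
  moreover have "(INF e\<in>E. z e) = 1"
  proof (rule antisym)
    have zP: "z \<in> E \<rightarrow>\<^sub>E {1..}" using calculation(1) by (simp add: F_fixed_point_def)
    show "1 \<le> (INF e\<in>E. z e)" by (rule INF_ge_1(1)[OF zP ne])
    have "c * (INF e\<in>E. z e) \<le> x e" if "e \<in> E" for e
    proof -
      have "c * (INF e\<in>E. z e) \<le> c * z e"
        using INF_ge_1(2)[OF zP ne that] c1 by (intro mult_left_mono) auto
      then show ?thesis using that c1 by (simp add: z_def)
    qed
    then have "c * (INF e\<in>E. z e) \<le> c" unfolding c_def by (intro cINF_greatest ne)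
    then show "(INF e\<in>E. z e) \<le> 1" using c1 by simp
  qed
  ultimately show ?thesis by (simp add: bounded_normalized_fp_def z_def)
qed

lemma bounded_normalized_fp_exists:
  assumes w: "supersolution G w" "bdd_above (w ` E)" and ne: "E \<noteq> {}"
  obtains z where "bounded_normalized_fp G z"
proof -
  obtain x where x: "F_fixed_point G x" "\<And>e. e \<in> E \<Longrightarrow> x e \<le> w e"
    using fixed_point_below_supersolution[OF w(1)] by blast
  obtain B where "\<And>e. e \<in> E \<Longrightarrow> w e \<le> B" using w(2) by (auto simp: bdd_above_def)
  then have "bdd_above (x ` E)"
    using x(2) by (intro bdd_aboveI2[of _ _ B]) (meson order_trans)
  then show ?thesis using that fixed_point_normalize[OF x(1) _ ne] by blast
qed

lemma infinite_imp_edges: "infinite V \<Longrightarrow> E \<noteq> {}"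
  by (metis empty_iff nonbacktracking_exists walk_edge_in)

lemma side_sum_strict_mono:
  assumes "\<And>e. e \<in> E \<Longrightarrow> x e \<le> y e" "f \<in> E" "u \<in> f" "f \<noteq> e" "x f < y f"
  shows "side_sum G u e x < side_sum G u e y"
  unfolding side_sum_def
  by (rule sum_strict_mono_ex1) (use assms finite_edges_at in auto)

text \<open>An excess of \<open>w\<close> over the fixed point \<open>y\<close> propagates along a walk to a region where \<open>y\<close> is
  constant and equal to its supremum.\<close>

lemma supersolution_le_SUP_imp_eq:
  assumes inf: "infinite V" and y: "bounded_normalized_fp G y"
    and w: "supersolution G w" "\<And>e. e \<in> E \<Longrightarrow> w e \<le> (SUP e\<in>E. y e)"
  shows "w = y"
proof (rule ccontr)
  assume "w \<noteq> y"
  note y' = bounded_normalized_fp_supersolution[OF y]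
  have w_bdd: "bdd_above (w ` E)" using w(2) by (rule bdd_aboveI2)
  have le: "y e \<le> w e" if "e \<in> E" for e
    using y w(1) w_bdd that by (rule bounded_normalized_fp_le_supersolution)
  have y1: "1 \<le> y e" if "e \<in> E" for e using supersolution_ge_1[OF y'(1) that] .
  have ynn: "0 \<le> y e" if "e \<in> E" for e using y1[OF that] by simp
  have "\<exists>e\<in>E. y e \<noteq> w e"
    using \<open>w \<noteq> y\<close> w(1) y'(1) PiE_ext[of w E "\<lambda>_. {1..}" y] by (auto simp: supersolution_def)
  then obtain e0 where e0: "e0 \<in> E" "y e0 < w e0" using le by (meson less_le)
  obtain v where v: "nonbacktracking G v" using nonbacktracking_exists[OF inf] by blast
  obtain p where p: "nonbacktracking G p" "walk_edge p 0 = e0"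
    using walk_from_edge[OF v e0(1)] by metis
  let ?e = "walk_edge p"
  have eE: "?e i \<in> E" for i by (rule walk_edge_in[OF p(1)])
  \<comment> \<open>Interior walk edges have a further edge at both ends, so equality holds even
    where \<open>y\<close> is 1.\<close>
  have y_eq: "(y (?e (Suc i)))\<^sup>2 = side_sum G (p (Suc i)) (?e (Suc i)) y * side_sum G (p (Suc (Suc i))) (?e (Suc i)) y" for i
    using fixed_point_eq_nonpendant[OF y'(3), of "p (Suc i)" "p (Suc (Suc i))"] eE[of "Suc i"]
      walk_side_sum_ge_1(2)[where x = y, OF p(1) y1, of i] walk_side_sum_ge_1(1)[where x = y, OF p(1) y1, of "Suc i"]
    by (simp add: walk_edge_def)
  \<comment> \<open>A strict excess on one edge enters one side sum of the next edge; the other side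
    sum is positive, and the equation for \<open>y\<close> against the inequality for
    \<open>w\<close> passes the excess on.\<close>
  have strict: "y (?e i) < w (?e i)" for i
  proof (induction i)
    case 0
    then show ?case using e0 p by simp
  next
    case (Suc i)
    let ?A = "side_sum G (p (Suc i)) (?e (Suc i))" and ?B = "side_sum G (p (Suc (Suc i))) (?e (Suc i))"
    have "?A y < ?A w"
      using le eE[of i] Suc walk_edge_neq[OF p(1), of i]
      by (intro side_sum_strict_mono[of y w "?e i"]) (auto simp: walk_edge_def)
    moreover have "1 \<le> ?B y" using walk_side_sum_ge_1(1)[where x = y, OF p(1) y1] .
    moreover have "?B y \<le> ?B w" using le by (rule side_sum_mono)
    moreover have "0 \<le> ?A y" using ynn by (rule side_sum_nonneg)
    ultimately have "?A y * ?B y < ?A w * ?B w"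
      by (intro mult_less_le_imp_less) auto
    also have "\<dots> \<le> (w (?e (Suc i)))\<^sup>2" by (rule supersolution_walk[OF w(1) p(1)])
    finally have "(y (?e (Suc i)))\<^sup>2 < (w (?e (Suc i)))\<^sup>2" by (simp add: y_eq)
    then show ?case by (rule power_less_imp_less_base) (use supersolution_ge_1[OF w(1) eE, of "Suc i"] in simp)
  qed
  obtain N where N: "\<And>i. N \<le> i \<Longrightarrow> no_branch p i"
    using eventually_no_branch[OF y'(1,2) p(1)] by (auto simp: eventually_sequentially)
  define s where "s i = ln (y (?e (Suc i))) - ln (y (?e i))" for i
  \<comment> \<open>Beyond the last branch \<open>y\<close> is a geometric progression along the
    walk. Its logarithmic slope tends to zero, so \<open>y\<close> is constant there.\<close>
  have s_Suc: "s (Suc i) = s i" if "N \<le> i" for i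
  proof -
    have "(y (?e (Suc i)))\<^sup>2 = y (?e i) * y (?e (Suc (Suc i)))"
      using y_eq[of i] no_branch_side_sum[OF p(1) N, of i] no_branch_side_sum[OF p(1) N, of "Suc i"] that by simp
    then have "ln ((y (?e (Suc i)))\<^sup>2) = ln (y (?e i) * y (?e (Suc (Suc i))))" by simp
    then show ?thesis
      using y1[OF eE, of i] y1[OF eE, of "Suc i"] y1[OF eE, of "Suc (Suc i)"]
      by (simp add: s_def ln_mult ln_realpow)
  qed
  have s_const: "s (k + N) = s N" for k
    by (induction k) (simp_all add: s_Suc)
  have "s \<longlonglongrightarrow> 0"
    using supersolution_walk_ln(2)[OF y'(1,2) p(1)] by (simp add: s_def[abs_def])
  then have "(\<lambda>k. s (k + N)) \<longlonglongrightarrow> 0" by (rule LIMSEQ_ignore_initial_segment)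
  then have "s N = 0" by (simp add: s_const LIMSEQ_const_iff)
  have const: "y (?e (k + N)) = y (?e N)" for k
  proof (induction k)
    case (Suc k)
    have "s (k + N) = 0" using s_const \<open>s N = 0\<close> by simp
    then show ?case using Suc y1[OF eE, of "k + N"] y1[OF eE, of "Suc (k + N)"] by (simp add: s_def)
  qed simp
  \<comment> \<open>Every edge starts a walk that joins the tail of \<open>p\<close>, and
    \<open>y\<close> is nondecreasing along it. The constant tail value is therefore the supremum of
    \<open>y\<close>, which \<open>w\<close> exceeds there.\<close>
  have "y f \<le> y (?e N)" if f: "f \<in> E" for f
  proof -
    obtain q k m where q: "nonbacktracking G q" "walk_edge q 0 = f" "\<And>i. q (k + i) = p (m + i)"
      using walk_from_edge[OF p(1) f] by metis
    have "y f \<le> y (walk_edge q (k + N))"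
      using supersolution_walk_mono[OF y'(1,2) q(1), of 0 "k + N"] q(2) by simp
    also have "walk_edge q (k + N) = ?e (m + N)"
      using q(3)[of N] q(3)[of "Suc N"] by (simp add: walk_edge_def)
    finally show ?thesis by (simp add: const)
  qed
  then have "(SUP e\<in>E. y e) \<le> y (?e N)" using e0(1) by (intro cSUP_least) auto
  then show False using w(2)[OF eE, of N] strict[of N] by simp
qed

text \<open>At the leaf the side sum is empty, so the product vanishes and the cutoff 1
  applies.\<close>

lemma pendant_fixed_point:
  assumes "F_fixed_point G x" "pendant G e"
  shows "x e = 1"
proof -
  obtain u where u: "e \<in> E" "u \<in> e" "card (nbrs G u) = 1" using assms(2) by (auto simp: pendant_def)
  obtain v where e: "e = {u, v}" by (rule edge_obtain_other[OF u(1,2)])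
  have "v \<in> nbrs G u" using u e by (simp add: nbrs_def)
  then have "nbrs G u = {v}" using u(3) by (metis card_1_singletonE singletonD)
  then have "{f \<in> E. u \<in> f} = {e}" using e by (simp add: edges_at)
  then have "{f \<in> E. u \<in> f \<and> f \<noteq> e} = {}" by blast
  then have "side_sum G u e x = 0" by (simp only: side_sum_def sum.empty)
  then show ?thesis using assms(1) u(1) e by (simp add: fixed_point_iff)
qed

lemma nonpendant_side_sum_ge_1:
  assumes x: "\<And>e. e \<in> E \<Longrightarrow> 1 \<le> x e" and uv: "{u, v} \<in> E" "\<not> pendant G {u, v}"
  shows "1 \<le> side_sum G u {u, v} x"
proof -
  have "v \<in> nbrs G u" using uv by (simp add: nbrs_def)
  moreover have "card (nbrs G u) \<noteq> 1" using uv by (auto simp: pendant_def)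
  ultimately obtain z where z: "z \<in> nbrs G u" "z \<noteq> v"
    by (metis is_singletonI' is_singleton_altdef empty_iff)
  then have "x {u, z} \<le> side_sum G u {u, v} x"
    using uv x by (intro side_sum_ge_edge) (auto simp: nbrs_def doubleton_eq_iff intro: order_trans[OF zero_le_one])
  then show ?thesis using x[of "{u, z}"] z by (auto simp: nbrs_def)
qed

text \<open>The first vertex of a longest path is a leaf: another neighbour would either extend the
  path or close a cycle.\<close>

lemma pendant_exists:
  assumes fin: "finite V" and acyc: "\<nexists>xs. is_cycle G xs" and ne: "E \<noteq> {}"
  obtains e where "pendant G e"
proof -
  define P where "P xs \<longleftrightarrow> 2 \<le> length xs \<and> distinct xs \<and> set xs \<subseteq> V \<and>
    (\<forall>i. Suc i < length xs \<longrightarrow> {xs ! i, xs ! Suc i} \<in> E)" for xs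
  obtain e where "e \<in> E" using ne by blast
  then obtain a b where "{a, b} \<in> E" "a \<noteq> b" by (metis edge_cases)
  then have "P [a, b]" using edge_verts by (auto simp: P_def less_Suc_eq)
  moreover have "\<forall>xs. P xs \<longrightarrow> length xs < Suc (card V)"
    using card_mono[OF fin] by (auto simp: P_def less_Suc_eq_le simp flip: distinct_card)
  ultimately obtain xs where xs: "P xs" and longest: "\<And>ys. P ys \<Longrightarrow> length ys \<le> length xs"
    using ex_has_greatest_nat[of P "[a, b]" length "Suc (card V)"] by blast
  let ?z = "xs ! 0"
  have edge: "{xs ! i, xs ! Suc i} \<in> E" if "Suc i < length xs" for i using xs that by (simp add: P_def)
  have len: "2 \<le> length xs" and dist: "distinct xs" using xs by (simp_all add: P_def)
  have e0: "{?z, xs ! 1} \<in> E" using edge[of 0] len by simp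
  have "u = xs ! 1" if u: "u \<in> nbrs G ?z" for u
  proof (rule ccontr)
    assume "u \<noteq> xs ! 1"
    have uz: "{u, ?z} \<in> E" using u by (simp add: nbrs_def insert_commute)
    show False
    proof (cases "u \<in> set xs")
      case False
      have "{(u # xs) ! i, (u # xs) ! Suc i} \<in> E" if "Suc i < length (u # xs)" for i
        using that uz edge by (cases i) auto
      then have "P (u # xs)"
        using xs False edge_verts[OF uz] unfolding P_def by auto
      then show False using longest[of "u # xs"] by simp
    next
      case True
      then obtain j where j: "j < length xs" "xs ! j = u" by (auto simp: in_set_conv_nth)
      have "j \<noteq> 0" using edge_neq[OF uz] j by (cases j) auto
      moreover have "j \<noteq> 1" using \<open>u \<noteq> xs ! 1\<close> j by auto
      ultimately have j2: "2 \<le> j" by simp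
      \<comment> \<open>The path up to \<open>u\<close> is closed by the edge from \<open>u\<close>
        back to its first vertex; \<open>j\<close> being at least 2 gives three vertices.\<close>
      have "is_cycle G (take (Suc j) xs)"
        unfolding is_cycle_def
      proof (intro conjI allI impI)
        show "3 \<le> length (take (Suc j) xs)" "distinct (take (Suc j) xs)" using j j2 dist by auto
        fix i assume i: "i < length (take (Suc j) xs)"
        show "{take (Suc j) xs ! i, take (Suc j) xs ! (Suc i mod length (take (Suc j) xs))} \<in> E"
        proof (cases "i = j")
          case True
          then show ?thesis using j uz by simp
        next
          case False
          then show ?thesis using i j edge[of i] by simp
        qed
      qed
      then show False using acyc by blast
    qed
  qed
  moreover have "xs ! 1 \<in> nbrs G ?z" using e0 by (simp add: nbrs_def)
  ultimately have "nbrs G ?z = {xs ! 1}" by blast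
  then have "pendant G {?z, xs ! 1}" using e0 by (auto simp: pendant_def)
  then show ?thesis by (rule that)
qed

end

text \<open>Passing to a subgraph only drops positive terms from the side sums.\<close>

lemma supersolution_restrict:
  assumes "lf_graph G" "lf_graph H" "subgraph H G" "supersolution G w"
  shows "supersolution H (restrict w (edges H))"
proof -
  interpret G: lf_graph G by fact
  interpret H: lf_graph H by fact
  have sub: "edges H \<subseteq> edges G" using assms(3) by (simp add: subgraph_def)
  have w1: "1 \<le> w e" if "e \<in> edges G" for e using G.supersolution_ge_1[OF assms(4) that] .
  have wnn: "0 \<le> w e" if "e \<in> edges G" for e using w1[OF that] by simp
  have side: "side_sum H u e (restrict w (edges H)) \<le> side_sum G u e w" for u e
  proof -
    have "side_sum H u e (restrict w (edges H)) = (\<Sum>f\<in>{f\<in>edges H. u \<in> f \<and> f \<noteq> e}. w f)"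
      by (simp add: side_sum_def)
    also have "\<dots> \<le> side_sum G u e w"
      unfolding side_sum_def using sub wnn G.finite_edges_at by (intro sum_mono2) auto
    finally show ?thesis .
  qed
  show ?thesis
    unfolding H.supersolution_iff
  proof (intro conjI allI impI)
    show "restrict w (edges H) \<in> edges H \<rightarrow>\<^sub>E {1..}" using sub w1 by auto
    fix u v assume uv: "{u, v} \<in> edges H"
    have "side_sum H u {u, v} (restrict w (edges H)) * side_sum H v {u, v} (restrict w (edges H))
      \<le> side_sum G u {u, v} w * side_sum G v {u, v} w"
      using sub wnn by (intro mult_mono side G.side_sum_nonneg H.side_sum_nonneg) auto
    also have "\<dots> \<le> (w {u, v})\<^sup>2" using uv sub by (intro G.supersolutionD[OF assms(4)]) auto
    finally show "side_sum H u {u, v} (restrict w (edges H)) * side_sum H v {u, v} (restrict w (edges H))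
      \<le> (restrict w (edges H) {u, v})\<^sup>2" using uv by simp
  qed
qed

section \<open>Curvature of tree edges\<close>

text \<open>Kantorovich duality as a certificate: \<open>f\<close> bounds the cost of every coupling
  from below, and a coupling on whose support the bound is tight is optimal.\<close>

lemma wasserstein1_eqI:
  assumes fin: "finite (set_pmf p)" "finite (set_pmf q)"
    and lip: "\<And>a b. a \<in> set_pmf p \<Longrightarrow> b \<in> set_pmf q \<Longrightarrow> f a - f b \<le> real (graph_dist G a b)"
    and marg: "map_pmf fst \<pi> = p" "map_pmf snd \<pi> = q"
    and opt: "\<And>a b. (a, b) \<in> set_pmf \<pi> \<Longrightarrow> f a - f b = real (graph_dist G a b)"
  shows "wasserstein1 G p q = measure_pmf.expectation p f - measure_pmf.expectation q f"
proof -
  let ?d = "\<lambda>(x, y). real (graph_dist G x y)"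
  have sub: "set_pmf \<rho> \<subseteq> set_pmf p \<times> set_pmf q"
    if "map_pmf fst \<rho> = p" "map_pmf snd \<rho> = q" for \<rho>
    using that by (auto simp: image_iff) force+
  then have finp: "finite (set_pmf \<rho>)" if "map_pmf fst \<rho> = p" "map_pmf snd \<rho> = q" for \<rho>
    using that fin finite_subset by blast
  have diff: "measure_pmf.expectation \<rho> (\<lambda>z. f (fst z) - f (snd z)) =
      measure_pmf.expectation p f - measure_pmf.expectation q f"
    if "map_pmf fst \<rho> = p" "map_pmf snd \<rho> = q" for \<rho>
  proof -
    have "measure_pmf.expectation \<rho> (\<lambda>z. f (fst z) - f (snd z)) =
        measure_pmf.expectation \<rho> (\<lambda>z. f (fst z)) - measure_pmf.expectation \<rho> (\<lambda>z. f (snd z))"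
      using finp[OF that] by (intro Bochner_Integration.integral_diff integrable_measure_pmf_finite)
    also have "\<dots> = measure_pmf.expectation (map_pmf fst \<rho>) f - measure_pmf.expectation (map_pmf snd \<rho>) f"
      by simp
    finally show ?thesis using that by simp
  qed
  show ?thesis
    unfolding wasserstein1_def
  proof (rule cInf_eq_minimum)
    have "measure_pmf.expectation \<pi> ?d = measure_pmf.expectation \<pi> (\<lambda>z. f (fst z) - f (snd z))"
      using opt by (intro integral_cong_AE) (auto simp: AE_measure_pmf_iff)
    then show "measure_pmf.expectation p f - measure_pmf.expectation q f
        \<in> {measure_pmf.expectation \<pi> ?d |\<pi>. map_pmf fst \<pi> = p \<and> map_pmf snd \<pi> = q}"
      using marg diff[OF marg] by force
  next
    fix c assume "c \<in> {measure_pmf.expectation \<pi> ?d |\<pi>. map_pmf fst \<pi> = p \<and> map_pmf snd \<pi> = q}"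
    then obtain \<rho> where \<rho>: "c = measure_pmf.expectation \<rho> ?d" "map_pmf fst \<rho> = p" "map_pmf snd \<rho> = q"
      by auto
    have "measure_pmf.expectation \<rho> (\<lambda>z. f (fst z) - f (snd z)) \<le> measure_pmf.expectation \<rho> ?d"
      using finp[OF \<rho>(2,3)] sub[OF \<rho>(2,3)] lip
      by (intro integral_mono_AE integrable_measure_pmf_finite) (auto simp: AE_measure_pmf_iff)
    then show "measure_pmf.expectation p f - measure_pmf.expectation q f \<le> c"
      using diff[OF \<rho>(2,3)] \<rho>(1) by simp
  qed
qed

text \<open>The mass common to \<open>p\<close> and \<open>q\<close> at \<open>x\<close> and at \<open>y\<close> stays in place, and the remaining
  masses are coupled independently. As \<open>p\<close> then has no mass left at \<open>y\<close>, nothing moves from \<open>y\<close>.\<close>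

lemma coupling_avoiding:
  fixes p q :: "'a pmf"
  assumes fin: "finite (set_pmf p)" "finite (set_pmf q)" and "x \<noteq> y"
    and le: "pmf q x \<le> pmf p x" "pmf p y \<le> pmf q y" "pmf q x + pmf p y < 1"
  obtains \<pi> where "map_pmf fst \<pi> = p" "map_pmf snd \<pi> = q" "(y, x) \<notin> set_pmf \<pi>"
proof -
  define m where "m = 1 - pmf q x - pmf p y"
  have "0 < m" using le(3) by (simp add: m_def)
  define h where "h a = (if a = x then pmf q x else if a = y then pmf p y else 0)" for a
  \<comment> \<open>The residues of \<open>p\<close> and \<open>q\<close> outside the common mass
    \<open>h\<close> both have total mass \<open>m\<close>; dividing their product by
    \<open>m\<close> gives the right marginals.\<close>
  define g where "g = (\<lambda>(a, b). (if a = b then h a else 0) + (pmf p a - h a) * (pmf q b - h b) / m)"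
  define A where "A = set_pmf p \<union> set_pmf q \<union> {x, y}"
  have finA: "finite A" and xyA: "x \<in> A" "y \<in> A" using fin by (auto simp: A_def)
  have h0: "0 \<le> h a" for a by (simp add: h_def)
  have hp: "h a \<le> pmf p a" and hq: "h a \<le> pmf q a" for a using le by (auto simp: h_def)
  have out: "pmf p a = 0" "pmf q a = 0" "h a = 0" if "a \<notin> A" for a
    using that by (auto simp: A_def h_def set_pmf_eq)
  have g0: "0 \<le> g z" for z
    using h0 hp hq \<open>0 < m\<close> by (cases z) (auto simp: g_def)
  have gout: "g z = 0" if "z \<notin> A \<times> A" for z
    using that out by (cases z) (auto simp: g_def)
  have sumh: "sum h A = pmf q x + pmf p y"
  proof -
    have "sum h A = sum h {x, y}"
      using finA xyA by (intro sum.mono_neutral_right) (auto simp: h_def)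
    then show ?thesis using \<open>x \<noteq> y\<close> by (simp add: h_def)
  qed
  have "sum (pmf p) A = 1" "sum (pmf q) A = 1"
    using finA by (auto intro!: sum_pmf_eq_1 simp: A_def)
  then have m: "(\<Sum>a\<in>A. pmf p a - h a) = m" "(\<Sum>a\<in>A. pmf q a - h a) = m"
    using sumh by (simp_all add: sum_subtractf m_def)
  have fstsum: "(\<Sum>b\<in>A. g (a, b)) = pmf p a" if "a \<in> A" for a
  proof -
    have "(\<Sum>b\<in>A. g (a, b)) = (\<Sum>b\<in>A. if a = b then h a else 0) + (pmf p a - h a) * (\<Sum>b\<in>A. pmf q b - h b) / m"
      by (simp add: g_def sum.distrib sum_distrib_left sum_divide_distrib)
    then show ?thesis using that finA m(2) \<open>0 < m\<close> by simp
  qed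
  have sndsum: "(\<Sum>a\<in>A. g (a, b)) = pmf q b" if "b \<in> A" for b
  proof -
    have "(\<Sum>a\<in>A. g (a, b)) = (\<Sum>a\<in>A. if a = b then h a else 0) + (\<Sum>a\<in>A. pmf p a - h a) * (pmf q b - h b) / m"
      by (simp add: g_def sum.distrib sum_distrib_right sum_divide_distrib)
    then show ?thesis using that finA m(1) \<open>0 < m\<close> by simp
  qed
  define \<pi> where "\<pi> = embed_pmf g"
  have prod_sum: "(\<Sum>z\<in>B \<times> C. g z) = (\<Sum>a\<in>B. \<Sum>b\<in>C. g (a, b))" for B C
    by (simp add: sum.cartesian_product)
  have tot: "(\<Sum>z\<in>A \<times> A. g z) = 1"
    using fstsum \<open>sum (pmf p) A = 1\<close> by (simp add: prod_sum)
  have "(\<integral>\<^sup>+z. ennreal (g z) \<partial>count_space UNIV) = (\<Sum>z\<in>A \<times> A. ennreal (g z))"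
    using finA gout by (intro nn_integral_count_space') auto
  also have "\<dots> = ennreal (\<Sum>z\<in>A \<times> A. g z)"
    using g0 by (intro sum_ennreal) auto
  finally have "(\<integral>\<^sup>+z. ennreal (g z) \<partial>count_space UNIV) = 1" using tot by simp
  then have pmf_\<pi>: "pmf \<pi> z = g z" for z
    unfolding \<pi>_def using g0 by (intro pmf_embed_pmf) auto
  have supp: "set_pmf \<pi> \<subseteq> A \<times> A" using gout pmf_\<pi> by (auto simp: set_pmf_eq)
  have fst_\<pi>: "map_pmf fst \<pi> = p"
  proof (rule pmf_eqI)
    fix a
    have "pmf (map_pmf fst \<pi>) a = measure \<pi> (fst -` {a} \<inter> set_pmf \<pi>)"
      by (simp add: pmf_map measure_Int_set_pmf)
    also have "\<dots> = measure \<pi> (({a} \<times> A) \<inter> set_pmf \<pi>)"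
      using supp by (intro arg_cong[of _ _ "measure \<pi>"]) auto
    also have "\<dots> = (\<Sum>z\<in>{a} \<times> A. g z)"
      using finA by (simp add: measure_Int_set_pmf measure_measure_pmf_finite pmf_\<pi>)
    also have "\<dots> = (\<Sum>b\<in>A. g (a, b))"
      by (simp add: prod_sum)
    also have "\<dots> = pmf p a" using fstsum gout out by (cases "a \<in> A") auto
    finally show "pmf (map_pmf fst \<pi>) a = pmf p a" .
  qed
  have snd_\<pi>: "map_pmf snd \<pi> = q"
  proof (rule pmf_eqI)
    fix b
    have "pmf (map_pmf snd \<pi>) b = measure \<pi> (snd -` {b} \<inter> set_pmf \<pi>)"
      by (simp add: pmf_map measure_Int_set_pmf)
    also have "\<dots> = measure \<pi> ((A \<times> {b}) \<inter> set_pmf \<pi>)"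
      using supp by (intro arg_cong[of _ _ "measure \<pi>"]) auto
    also have "\<dots> = (\<Sum>z\<in>A \<times> {b}. g z)"
      using finA by (simp add: measure_Int_set_pmf measure_measure_pmf_finite pmf_\<pi>)
    also have "\<dots> = (\<Sum>a\<in>A. g (a, b))"
      by (simp add: prod_sum)
    also have "\<dots> = pmf q b" using sndsum gout out by (cases "b \<in> A") auto
    finally show "pmf (map_pmf snd \<pi>) b = pmf q b" .
  qed
  have "(y, x) \<notin> set_pmf \<pi>"
    using \<open>x \<noteq> y\<close> by (simp add: set_pmf_eq pmf_\<pi> g_def h_def)
  then show ?thesis using that fst_\<pi> snd_\<pi> by blast
qed

lemma graph_dist_eqI:
  assumes "(x, y) \<in> adj_rel G ^^ n" "\<And>m. m < n \<Longrightarrow> (x, y) \<notin> adj_rel G ^^ m"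
  shows "graph_dist G x y = n"
  unfolding graph_dist_def using assms by (intro Least_equality) (auto simp: not_less[symmetric])

section \<open>Short distances and Lin-Lu-Yau curvature in a tree\<close>

locale tree_graph = lf_graph +
  assumes acyclic: "\<nexists>xs. is_cycle G xs"
begin

lemma no_3_cycle: "{a, b} \<in> E \<Longrightarrow> {b, c} \<in> E \<Longrightarrow> {c, a} \<notin> E"
proof
  assume *: "{a, b} \<in> E" "{b, c} \<in> E" "{c, a} \<in> E"
  then have "is_cycle G [a, b, c]"
    using edge_neq by (auto simp: is_cycle_def less_Suc_eq)
  then show False using acyclic by blast
qed

lemma no_4_cycle: "{a, b} \<in> E \<Longrightarrow> {b, c} \<in> E \<Longrightarrow> {c, d} \<in> E \<Longrightarrow> a \<noteq> c \<Longrightarrow> b \<noteq> d \<Longrightarrow> {d, a} \<notin> E"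
proof
  assume *: "{a, b} \<in> E" "{b, c} \<in> E" "{c, d} \<in> E" "a \<noteq> c" "b \<noteq> d" "{d, a} \<in> E"
  then have "is_cycle G [a, b, c, d]"
    using edge_neq by (auto simp: is_cycle_def less_Suc_eq)
  then show False using acyclic by blast
qed

lemma no_5_cycle:
  assumes *: "{a, b} \<in> E" "{b, c} \<in> E" "{c, d} \<in> E" "{d, e} \<in> E" "{e, a} \<in> E"
    and "a \<noteq> c" "b \<noteq> d" "c \<noteq> e"
  shows False
proof -
  have "a \<noteq> d" using no_3_cycle[of a b c] * by (auto simp: insert_commute)
  moreover have "b \<noteq> e" using no_3_cycle[of b c d] * by (auto simp: insert_commute)
  ultimately have "is_cycle G [a, b, c, d, e]"
    using edge_neq assms by (auto simp: is_cycle_def less_Suc_eq)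
  then show False using acyclic by blast
qed

lemma graph_dist_self: "graph_dist G a a = 0"
  by (rule graph_dist_eqI) auto

lemma graph_dist_edge: "{a, b} \<in> E \<Longrightarrow> graph_dist G a b = 1"
  by (rule graph_dist_eqI) (auto simp: adj_rel_def dest: edge_neq)

lemma graph_dist_2: "{a, b} \<in> E \<Longrightarrow> {b, c} \<in> E \<Longrightarrow> a \<noteq> c \<Longrightarrow> graph_dist G a c = 2"
proof (rule graph_dist_eqI)
  assume *: "{a, b} \<in> E" "{b, c} \<in> E" "a \<noteq> c"
  then show "(a, c) \<in> adj_rel G ^^ 2" by (auto simp: numeral_2_eq_2 adj_rel_def)
  fix m :: nat assume "m < 2"
  then have "m = 0 \<or> m = 1" by auto
  then show "(a, c) \<notin> adj_rel G ^^ m"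
    using * no_3_cycle[of a b c] by (auto simp: adj_rel_def insert_commute)
qed

text \<open>A shorter walk would close a cycle of length at most 5. Distance 3 is the largest that
  occurs between the two walk measures of an edge.\<close>

lemma graph_dist_3:
  assumes *: "{a, b} \<in> E" "{b, c} \<in> E" "{c, d} \<in> E" "a \<noteq> c" "b \<noteq> d"
  shows "graph_dist G a d = 3"
proof (rule graph_dist_eqI)
  show "(a, d) \<in> adj_rel G ^^ 3" using * by (auto simp: numeral_3_eq_3 adj_rel_def)
  have "a \<noteq> d" using no_3_cycle[of a b c] * by (auto simp: insert_commute)
  moreover have "{a, d} \<notin> E" using no_4_cycle[of a b c d] * by (auto simp: insert_commute)
  moreover have False if t: "{a, t} \<in> E" "{t, d} \<in> E" for t
  proof (cases "t = c \<or> t = b")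
    case True
    then show False using no_3_cycle[of a b c] no_3_cycle[of b c d] * t by (auto simp: insert_commute)
  next
    case False
    then show False using no_5_cycle[of a b c d t] * t by (auto simp: insert_commute)
  qed
  moreover fix m :: nat assume "m < 3"
  then have "m = 0 \<or> m = 1 \<or> m = 2" by auto
  ultimately show "(a, d) \<notin> adj_rel G ^^ m"
    by (auto simp: adj_rel_def numeral_2_eq_2)
qed

lemma pos_weight_pos: "pos_weight G w \<Longrightarrow> e \<in> E \<Longrightarrow> 0 < w e"
  by (auto simp: pos_weight_def PiE_iff)

lemma expectation_lazy_walk:
  fixes f :: "'a \<Rightarrow> real"
  assumes w: "pos_weight G w" and x: "nbrs G x \<noteq> {}" and \<alpha>: "0 \<le> \<alpha>" "\<alpha> \<le> 1"
  shows "measure_pmf.expectation (lazy_walk G w \<alpha> x) f =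
    \<alpha> * f x + (1 - \<alpha>) / wdeg G w x * (\<Sum>z\<in>nbrs G x. f z * w {x, z})"
proof -
  have xV: "x \<in> V" using x edge_verts by (auto simp: nbrs_def)
  note pmf = pmf_lazy_walk[OF simple lf w xV x \<alpha>]
  have x_nbr: "x \<notin> nbrs G x" using edge_neq[of x x] by (auto simp: nbrs_def)
  have "measure_pmf.expectation (lazy_walk G w \<alpha> x) f =
      (\<Sum>z\<in>insert x (nbrs G x). f z * pmf (lazy_walk G w \<alpha> x) z)"
    using finite_nbrs by (intro integral_measure_pmf_real) (auto simp: set_pmf_eq pmf split: if_splits)
  also have "\<dots> = f x * \<alpha> + (\<Sum>z\<in>nbrs G x. f z * pmf (lazy_walk G w \<alpha> x) z)"
    using finite_nbrs x_nbr by (simp add: pmf)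
  also have "(\<Sum>z\<in>nbrs G x. f z * pmf (lazy_walk G w \<alpha> x) z) =
      (\<Sum>z\<in>nbrs G x. (1 - \<alpha>) / wdeg G w x * (f z * w {x, z}))"
    using x_nbr by (intro sum.cong) (auto simp: pmf)
  finally show ?thesis by (simp add: sum_distrib_left)
qed

text \<open>The potential \<open>f\<close> falls by exactly the distance on every pair of support
  points except \<open>(y, x)\<close>, so a coupling that moves nothing from \<open>y\<close> to
  \<open>x\<close> is optimal.\<close>

lemma kappa_edge:
  assumes w: "pos_weight G w" and xy: "{x, y} \<in> E" and \<alpha>: "1 / 2 < \<alpha>" "\<alpha> < 1"
  shows "kappa G w \<alpha> x y = (1 - \<alpha>) * (2 * (w {x, y} / wdeg G w x + w {x, y} / wdeg G w y - 1))"
proof -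
  let ?p = "lazy_walk G w \<alpha> x" and ?q = "lazy_walk G w \<alpha> y" and ?w = "w {x, y}"
  have nx: "y \<in> nbrs G x" and ny: "x \<in> nbrs G y" using xy by (auto simp: nbrs_def insert_commute)
  have xV: "x \<in> V" "y \<in> V" using edge_verts[OF xy] by auto
  have neq: "x \<noteq> y" using edge_neq[OF xy] .
  have a: "0 \<le> \<alpha>" "\<alpha> \<le> 1" using \<alpha> by auto
  have xx: "x \<notin> nbrs G x" "y \<notin> nbrs G y" using edge_neq[of x x] edge_neq[of y y] by (auto simp: nbrs_def)
  have pmfp: "pmf ?p z = (if z = x then \<alpha> else if z \<in> nbrs G x then (1 - \<alpha>) * w {x, z} / wdeg G w x else 0)" for z
    using nx by (intro pmf_lazy_walk simple lf w xV a) auto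
  have pmfq: "pmf ?q z = (if z = y then \<alpha> else if z \<in> nbrs G y then (1 - \<alpha>) * w {y, z} / wdeg G w y else 0)" for z
    using ny by (intro pmf_lazy_walk simple lf w xV a) auto
  have suppp: "set_pmf ?p \<subseteq> insert x (nbrs G x)" and suppq: "set_pmf ?q \<subseteq> insert y (nbrs G y)"
    by (auto simp: set_pmf_eq pmfp pmfq split: if_splits)
  have fin: "finite (set_pmf ?p)" "finite (set_pmf ?q)"
    using finite_subset[OF suppp] finite_subset[OF suppq] finite_nbrs by auto
  have yx: "{y, x} = {x, y}" by auto
  have wpos: "0 < ?w" using pos_weight_pos[OF w xy] .
  have wd: "?w \<le> wdeg G w x" "?w \<le> wdeg G w y"
    using side_sum_wdeg[OF xy, of w] side_sum_wdeg[of y x w] xy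
      side_sum_nonneg[of w x "{x, y}"] side_sum_nonneg[of w y "{x, y}"] pos_weight_pos[OF w]
    by (auto simp: yx less_imp_le)
  \<comment> \<open>For \<alpha> above 1/2 the staying mass exceeds whatever the other endpoint
    sends, as \<open>coupling_avoiding\<close> requires.\<close>
  have frac: "(1 - \<alpha>) * ?w / d \<le> 1 - \<alpha>" if "?w \<le> d" for d
    using that wpos \<alpha> by (simp add: divide_le_eq mult_left_mono)
  have qx: "pmf ?q x = (1 - \<alpha>) * ?w / wdeg G w y" and py: "pmf ?p y = (1 - \<alpha>) * ?w / wdeg G w x"
    using neq nx ny by (simp_all add: pmfp pmfq yx)
  obtain \<pi> where \<pi>: "map_pmf fst \<pi> = ?p" "map_pmf snd \<pi> = ?q" "(y, x) \<notin> set_pmf \<pi>"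
  proof (rule coupling_avoiding[OF fin neq])
    show "pmf ?q x \<le> pmf ?p x" "pmf ?p y \<le> pmf ?q y" "pmf ?q x + pmf ?p y < 1"
      using frac[OF wd(1)] frac[OF wd(2)] \<alpha> unfolding qx py by (simp_all add: pmfp pmfq)
  qed
  \<comment> \<open>A height function decreasing by one per edge in the direction from
    \<open>x\<close> to \<open>y\<close>: 2 behind \<open>x\<close>, then 1, 0, and -1 behind
    \<open>y\<close>.\<close>
  define f :: "'a \<Rightarrow> real" where
    "f z = (if z = x then 1 else if z = y then 0 else if z \<in> nbrs G x then 2 else -1)" for z
  have disj: "z \<notin> nbrs G y" if "z \<in> nbrs G x" for z
    using that no_3_cycle[of z x y] xy by (auto simp: nbrs_def insert_commute)
  have dist: "f a - f b \<le> real (graph_dist G a b)"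
    "(a, b) \<noteq> (y, x) \<Longrightarrow> f a - f b = real (graph_dist G a b)"
    if "a \<in> set_pmf ?p" "b \<in> set_pmf ?q" for a b
  proof -
    have ca: "a = x \<or> a = y \<or> (a \<in> nbrs G x \<and> a \<noteq> x \<and> a \<noteq> y)" using that suppp xx by auto
    have cb: "b = x \<or> b = y \<or> (b \<in> nbrs G y \<and> b \<noteq> x \<and> b \<noteq> y \<and> b \<notin> nbrs G x)"
      using that suppq xx disj by auto
    have 1: "graph_dist G x y = 1" "graph_dist G y x = 1" using xy by (simp_all add: graph_dist_edge yx)
    have 2: "graph_dist G a x = 1" "graph_dist G a y = 2" if "a \<in> nbrs G x" "a \<noteq> y"
      using that xy graph_dist_2[of a x y] by (simp_all add: graph_dist_edge nbrs_def insert_commute)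
    have 3: "graph_dist G y b = 1" "graph_dist G x b = 2" if "b \<in> nbrs G y" "b \<noteq> x"
      using that xy graph_dist_2[of x y b] by (simp_all add: graph_dist_edge nbrs_def insert_commute)
    have 4: "graph_dist G a b = 3" if "a \<in> nbrs G x" "a \<noteq> y" "b \<in> nbrs G y" "b \<noteq> x"
      using that xy by (intro graph_dist_3[of a x y b]) (auto simp: nbrs_def insert_commute)
    show "f a - f b \<le> real (graph_dist G a b)"
      using ca cb 1 2 3 4 neq by (elim disjE conjE) (simp_all add: f_def graph_dist_self)
    show "(a, b) \<noteq> (y, x) \<Longrightarrow> f a - f b = real (graph_dist G a b)"
      using ca cb 1 2 3 4 neq by (elim disjE conjE) (simp_all add: f_def graph_dist_self)
  qed
  have W: "wasserstein1 G ?p ?q = measure_pmf.expectation ?p f - measure_pmf.expectation ?q f"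
  proof (rule wasserstein1_eqI[OF fin dist(1) \<pi>(1,2)])
    fix a b assume ab: "(a, b) \<in> set_pmf \<pi>"
    then have "a \<in> set_pmf ?p" "b \<in> set_pmf ?q"
      unfolding \<pi>(1,2)[symmetric] by force+
    then show "f a - f b = real (graph_dist G a b)" using dist(2) ab \<pi>(3) by blast
  qed
  have sx: "(\<Sum>z\<in>nbrs G x. f z * w {x, z}) = 2 * (wdeg G w x - ?w)"
  proof -
    have "(\<Sum>z\<in>nbrs G x. f z * w {x, z}) = (\<Sum>z\<in>nbrs G x - {y}. f z * w {x, z})"
      using finite_nbrs nx neq by (subst sum.remove[of _ y]) (auto simp: f_def)
    also have "\<dots> = (\<Sum>z\<in>nbrs G x - {y}. 2 * w {x, z})"
      using xx by (intro sum.cong) (auto simp: f_def)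
    also have "\<dots> = 2 * (wdeg G w x - ?w)"
      using finite_nbrs nx by (simp add: wdeg_def sum_distrib_left[symmetric] sum_diff1)
    finally show ?thesis .
  qed
  have sy: "(\<Sum>z\<in>nbrs G y. f z * w {y, z}) = ?w - (wdeg G w y - ?w)"
  proof -
    have "(\<Sum>z\<in>nbrs G y. f z * w {y, z}) = ?w + (\<Sum>z\<in>nbrs G y - {x}. f z * w {y, z})"
      using finite_nbrs ny by (subst sum.remove[of _ x]) (auto simp: f_def yx)
    also have "(\<Sum>z\<in>nbrs G y - {x}. f z * w {y, z}) = (\<Sum>z\<in>nbrs G y - {x}. - w {y, z})"
      using xx disj by (intro sum.cong) (auto simp: f_def)
    also have "\<dots> = - (wdeg G w y - ?w)"
      using finite_nbrs ny by (simp add: wdeg_def sum_negf sum_diff1 yx)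
    finally show ?thesis by simp
  qed
  have ne: "nbrs G x \<noteq> {}" "nbrs G y \<noteq> {}" using nx ny by auto
  have dpos: "0 < wdeg G w x" "0 < wdeg G w y" using wd wpos by auto
  have "kappa G w \<alpha> x y = 1 - (\<alpha> + (1 - \<alpha>) / wdeg G w x * (2 * (wdeg G w x - ?w))
      - (1 - \<alpha>) / wdeg G w y * (?w - (wdeg G w y - ?w)))"
    unfolding kappa_def W expectation_lazy_walk[OF w ne(1) a] expectation_lazy_walk[OF w ne(2) a] sx sy
    using neq by (simp add: f_def)
  also have "\<dots> = (1 - \<alpha>) * (2 * (?w / wdeg G w x + ?w / wdeg G w y - 1))"
    using dpos by (simp add: field_simps)
  finally show ?thesis .
qed

text \<open>The quotient is constant for \<alpha> in (1/2, 1), so the limit is its value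
  there.\<close>

lemma kappa_LLY_edge:
  assumes w: "pos_weight G w" and xy: "{x, y} \<in> E"
  shows "kappa_LLY G w x y = 2 * (w {x, y} / wdeg G w x + w {x, y} / wdeg G w y - 1)"
proof -
  let ?k = "2 * (w {x, y} / wdeg G w x + w {x, y} / wdeg G w y - 1)"
  have "eventually (\<lambda>\<alpha>. \<alpha> \<in> {1/2<..<1}) (at_left (1::real))"
    by (rule eventually_at_left_real) simp
  then have "eventually (\<lambda>\<alpha>. kappa G w \<alpha> x y / (1 - \<alpha>) = ?k) (at_left 1)"
    by eventually_elim (use kappa_edge[OF assms] in auto)
  then have "((\<lambda>\<alpha>. kappa G w \<alpha> x y / (1 - \<alpha>)) \<longlongrightarrow> ?k) (at_left 1)"
    by (rule tendsto_eventually)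
  then show ?thesis
    unfolding kappa_LLY_def by (intro tendsto_Lim) auto
qed

text \<open>With weight c and side sums a, b the weighted degrees are c + a and c + b, and c/(c+a) +
  c/(c+b) - 1 = (c^2 - a b) / ((c+a)(c+b)).\<close>

lemma kappa_LLY_sign:
  assumes w: "pos_weight G w" and xy: "{x, y} \<in> E"
  shows "0 \<le> kappa_LLY G w x y \<longleftrightarrow> side_sum G x {x, y} w * side_sum G y {x, y} w \<le> (w {x, y})\<^sup>2"
    and "kappa_LLY G w x y = 0 \<longleftrightarrow> side_sum G x {x, y} w * side_sum G y {x, y} w = (w {x, y})\<^sup>2"
proof -
  define c where "c = w {x, y}"
  define a where "a = side_sum G x {x, y} w"
  define b where "b = side_sum G y {x, y} w"
  have c: "0 < c" using pos_weight_pos[OF w xy] by (simp add: c_def)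
  have ab: "0 \<le> a" "0 \<le> b"
    using side_sum_nonneg[of w] pos_weight_pos[OF w] by (auto simp: a_def b_def less_imp_le)
  have yx: "{y, x} = {x, y}" by auto
  have "wdeg G w x = c + a" "wdeg G w y = c + b"
    using side_sum_wdeg[OF xy, of w] side_sum_wdeg[of y x w] xy by (simp_all add: a_def b_def c_def yx)
  then have "kappa_LLY G w x y = 2 * (c / (c + a) + c / (c + b) - 1)"
    unfolding kappa_LLY_edge[OF w xy] by (simp add: c_def)
  also have "\<dots> = 2 * (c\<^sup>2 - a * b) / ((c + a) * (c + b))"
    using c ab by (simp add: divide_simps power2_eq_square) (simp add: algebra_simps)
  finally have k: "kappa_LLY G w x y = 2 * (c\<^sup>2 - a * b) / ((c + a) * (c + b))" .
  have pos: "0 < (c + a) * (c + b)" using c ab by simp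
  show "0 \<le> kappa_LLY G w x y \<longleftrightarrow> side_sum G x {x, y} w * side_sum G y {x, y} w \<le> (w {x, y})\<^sup>2"
    unfolding k a_def[symmetric] b_def[symmetric] c_def[symmetric] using pos by (simp add: zero_le_divide_iff)
  show "kappa_LLY G w x y = 0 \<longleftrightarrow> side_sum G x {x, y} w * side_sum G y {x, y} w = (w {x, y})\<^sup>2"
    unfolding k a_def[symmetric] b_def[symmetric] c_def[symmetric] using pos by auto
qed

end

section \<open>Distortion and exhaustions\<close>

lemma ereal_SUP_le_iff:
  fixes f :: "'b \<Rightarrow> real"
  assumes "A \<noteq> {}" "bdd_above (f ` A)"
  shows "ereal (SUP a\<in>A. f a) \<le> c \<longleftrightarrow> (\<forall>a\<in>A. ereal (f a) \<le> c)"
proof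
  assume "ereal (SUP a\<in>A. f a) \<le> c"
  then show "\<forall>a\<in>A. ereal (f a) \<le> c"
    using assms(2) by (meson cSUP_upper ereal_less_eq(3) order_trans)
next
  assume *: "\<forall>a\<in>A. ereal (f a) \<le> c"
  show "ereal (SUP a\<in>A. f a) \<le> c"
  proof (cases c)
    case (real d)
    then show ?thesis using * assms(1) by (auto intro!: cSUP_least)
  next
    case MInf
    then show ?thesis using * assms(1) by auto
  qed simp
qed

lemma ereal_SUP_bdd:
  fixes f :: "'b \<Rightarrow> real"
  assumes "A \<noteq> {}" "bdd_above (f ` A)"
  shows "ereal (SUP a\<in>A. f a) = (SUP a\<in>A. ereal (f a))"
proof (rule antisym)
  show "ereal (SUP a\<in>A. f a) \<le> (SUP a\<in>A. ereal (f a))"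
    unfolding ereal_SUP_le_iff[OF assms] by (auto intro: SUP_upper)
  show "(SUP a\<in>A. ereal (f a)) \<le> ereal (SUP a\<in>A. f a)"
    using assms(2) by (intro SUP_least) (auto intro: cSUP_upper)
qed

context tree_graph
begin

lemma supersolution_admissible:
  assumes "supersolution G w"
  shows "admissible G w"
proof -
  have w: "pos_weight G w"
    using assms by (auto simp: pos_weight_def supersolution_def PiE_iff dest!: bspec intro: less_le_trans[OF zero_less_one])
  then show ?thesis
    unfolding admissible_def using supersolutionD[OF assms] kappa_LLY_sign(1)[OF w] by blast
qed

lemma admissible_supersolution:
  assumes "admissible G w" "\<And>e. e \<in> E \<Longrightarrow> 1 \<le> w e"
  shows "supersolution G w"
  unfolding supersolution_iff
proof (intro conjI allI impI)
  have w: "pos_weight G w" using assms(1) by (simp add: admissible_def)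
  then show "w \<in> E \<rightarrow>\<^sub>E {1..}" using assms(2) by (auto simp: pos_weight_def PiE_iff)
  fix u v assume uv: "{u, v} \<in> E"
  then have "0 \<le> kappa_LLY G w u v" using assms(1) by (simp add: admissible_def)
  then show "side_sum G u {u, v} w * side_sum G v {u, v} w \<le> (w {u, v})\<^sup>2"
    by (simp add: kappa_LLY_sign(1)[OF w uv])
qed

text \<open>Division by the infimum: the curvature condition is homogeneous of degree 2, and the
  largest quotient that can arise is the distortion.\<close>

lemma admissible_normalize:
  assumes w: "admissible G w" "distortion G w < \<infinity>" and ne: "E \<noteq> {}"
  obtains v where "supersolution G v" "bdd_above (v ` E)" "\<forall>e\<in>E. ereal (v e) \<le> distortion G w"
proof -
  define i where "i = (INF e\<in>E. w e)"
  have pw: "pos_weight G w" using w(1) by (simp add: admissible_def)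
  note pos = pos_weight_pos[OF pw]
  have bdd: "bdd_above (w ` E)" and "i \<noteq> 0"
    using w(2) by (auto simp: distortion_def i_def split: if_splits)
  have "0 \<le> i" unfolding i_def using pos by (intro cINF_greatest ne) (auto intro: less_imp_le)
  with \<open>i \<noteq> 0\<close> have i: "0 < i" by simp
  have i_le: "i \<le> w e" if "e \<in> E" for e
    unfolding i_def using that pos by (intro cINF_lower) (auto intro!: bdd_belowI2[of _ 0] less_imp_le)
  define v where "v = (\<lambda>e\<in>E. (1 / i) * w e)"
  have v1: "1 \<le> v e" if "e \<in> E" for e using that i i_le[OF that] by (simp add: v_def)
  have "supersolution G v"
    unfolding supersolution_iff
  proof (intro conjI allI impI)
    show "v \<in> E \<rightarrow>\<^sub>E {1..}" using v1 by (auto simp: v_def)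
    fix a b assume ab: "{a, b} \<in> E"
    then have "0 \<le> kappa_LLY G w a b" using w(1) by (simp add: admissible_def)
    then have "side_sum G a {a, b} w * side_sum G b {a, b} w \<le> (w {a, b})\<^sup>2"
      by (simp add: kappa_LLY_sign(1)[OF pw ab])
    then have "(1 / i)\<^sup>2 * (side_sum G a {a, b} w * side_sum G b {a, b} w) \<le> (1 / i)\<^sup>2 * (w {a, b})\<^sup>2"
      by (intro mult_left_mono) auto
    then show "side_sum G a {a, b} v * side_sum G b {a, b} v \<le> (v {a, b})\<^sup>2"
      unfolding v_def side_sum_scale using ab by (simp add: power2_eq_square)
  qed
  moreover have le: "v e \<le> (SUP e\<in>E. w e) / i" if "e \<in> E" for e
    using that i bdd by (simp add: v_def divide_right_mono cSUP_upper)
  moreover have "distortion G w = ereal ((SUP e\<in>E. w e) / i)"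
    using bdd \<open>i \<noteq> 0\<close> by (simp add: distortion_def i_def)
  moreover have "bdd_above (v ` E)" using le by (rule bdd_aboveI2)
  ultimately show ?thesis using that[of v] by simp
qed

lemma distortion_normalized:
  "bdd_above (w ` E) \<Longrightarrow> (INF e\<in>E. w e) = 1 \<Longrightarrow> distortion G w = ereal (SUP e\<in>E. w e)"
  by (simp add: distortion_def)

lemma bounded_normalized_fp_distortion:
  "bounded_normalized_fp G y \<Longrightarrow> distortion G y = ereal (SUP e\<in>E. y e)"
  by (intro distortion_normalized) (auto simp: bounded_normalized_fp_def)

text \<open>A competitor of finite distortion, once normalized, is a bounded supersolution and so
  lies above \<open>y\<close> on every edge.\<close>

lemma bounded_normalized_fp_DN_LLY:
  assumes y: "bounded_normalized_fp G y" and ne: "E \<noteq> {}"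
  shows "DN_LLY G = ereal (SUP e\<in>E. y e)"
proof -
  note y' = bounded_normalized_fp_supersolution[OF y]
  have "(INF w\<in>{w. admissible G w}. distortion G w) = ereal (SUP e\<in>E. y e)"
  proof (rule antisym)
    show "(INF w\<in>{w. admissible G w}. distortion G w) \<le> ereal (SUP e\<in>E. y e)"
      using supersolution_admissible[OF y'(1)] bounded_normalized_fp_distortion[OF y]
      by (metis INF_lower mem_Collect_eq)
    show "ereal (SUP e\<in>E. y e) \<le> (INF w\<in>{w. admissible G w}. distortion G w)"
    proof (rule INF_greatest)
      fix w assume w: "w \<in> {w. admissible G w}"
      show "ereal (SUP e\<in>E. y e) \<le> distortion G w"
      proof (cases "distortion G w < \<infinity>")
        case True
        have "admissible G w" using w by simp
        then obtain v where v: "supersolution G v" "bdd_above (v ` E)"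
          "\<forall>e\<in>E. ereal (v e) \<le> distortion G w"
          using True ne by (rule admissible_normalize)
        have "ereal (y e) \<le> distortion G w" if "e \<in> E" for e
          using bounded_normalized_fp_le_supersolution[OF y v(1,2) that] v(3) that
          by (meson ereal_less_eq(3) order_trans)
        then show ?thesis using ereal_SUP_le_iff[OF ne y'(2)] by blast
      qed simp
    qed
  qed
  then show ?thesis using ne by (simp add: DN_LLY_def)
qed

lemma bounded_normalized_fp_optimal:
  assumes "bounded_normalized_fp G y" "E \<noteq> {}"
  shows "optimal G y" "normalized_weight G y"
proof -
  have "admissible G y"
    using bounded_normalized_fp_supersolution(1)[OF assms(1)] by (rule supersolution_admissible)
  then show "optimal G y" "normalized_weight G y"
    using assms bounded_normalized_fp_DN_LLY bounded_normalized_fp_distortion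
    by (simp_all add: optimal_def normalized_weight_def admissible_def bounded_normalized_fp_def)
qed

lemma DN_LLY_finite_iff:
  assumes ne: "E \<noteq> {}"
  shows "DN_LLY G < \<infinity> \<longleftrightarrow> (\<exists>x. bounded_normalized_fp G x)"
proof
  assume "DN_LLY G < \<infinity>"
  then have "(INF w\<in>{w. admissible G w}. distortion G w) < \<infinity>"
    using ne by (simp only: DN_LLY_def if_False)
  then obtain w where "admissible G w" "distortion G w < \<infinity>"
    unfolding INF_less_iff by blast
  then obtain v where v: "supersolution G v" "bdd_above (v ` E)"
    using ne by (rule admissible_normalize)
  obtain x where "bounded_normalized_fp G x" by (rule bounded_normalized_fp_exists[OF v ne])
  then show "\<exists>x. bounded_normalized_fp G x" by blast
next
  assume "\<exists>x. bounded_normalized_fp G x"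
  then obtain x where "bounded_normalized_fp G x" by blast
  then show "DN_LLY G < \<infinity>" using bounded_normalized_fp_DN_LLY[OF _ ne] by simp
qed

text \<open>Optimality gives \<open>x\<close> the same supremum as \<open>y\<close>, which is the
  bound that the rigidity lemma asks for.\<close>

lemma optimal_normalized_unique:
  assumes inf: "infinite V" and y: "bounded_normalized_fp G y"
    and x: "optimal G x" "normalized_weight G x"
  shows "x = y"
proof (rule supersolution_le_SUP_imp_eq[OF inf y])
  have ne: "E \<noteq> {}" by (rule infinite_imp_edges[OF inf])
  have INF: "(INF e\<in>E. x e) = 1" and fin: "distortion G x < \<infinity>" and px: "pos_weight G x"
    using x(2) by (auto simp: normalized_weight_def)
  then have bdd: "bdd_above (x ` E)" by (auto simp: distortion_def split: if_splits)
  have x1: "1 \<le> x e" if "e \<in> E" for e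
    unfolding INF[symmetric] using that pos_weight_pos[OF px]
    by (intro cINF_lower) (auto intro!: bdd_belowI2[of _ 0] less_imp_le)
  then show "supersolution G x" using x(1) by (intro admissible_supersolution) (auto simp: optimal_def)
  have "ereal (SUP e\<in>E. x e) = ereal (SUP e\<in>E. y e)"
    using x(1) bounded_normalized_fp_DN_LLY[OF y ne] distortion_normalized[OF bdd INF]
    by (simp add: optimal_def)
  then show "x e \<le> (SUP e\<in>E. y e)" if "e \<in> E" for e
    using cSUP_upper[OF that bdd] by simp
qed

lemma bounded_normalized_fp_kappa_LLY:
  assumes y: "bounded_normalized_fp G y" and e: "{u, v} \<in> E" "\<not> pendant G {u, v}"
  shows "kappa_LLY G y u v = 0"
proof -
  note y' = bounded_normalized_fp_supersolution[OF y]
  have "pos_weight G y" using supersolution_admissible[OF y'(1)] by (simp add: admissible_def)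
  moreover have "1 \<le> side_sum G u {u, v} y" "1 \<le> side_sum G v {v, u} y"
    using e nonpendant_side_sum_ge_1[OF supersolution_ge_1[OF y'(1)], where u = u and v = v]
      nonpendant_side_sum_ge_1[OF supersolution_ge_1[OF y'(1)], where u = v and v = u]
    by (simp_all add: insert_commute)
  ultimately show ?thesis
    using kappa_LLY_sign(2) fixed_point_eq_nonpendant[OF y'(3) e(1)] e(1)
    by (simp add: insert_commute)
qed

lemma finite_edges: "finite V \<Longrightarrow> finite E"
  using simple by (intro finite_subset[of E "Pow V"]) (auto simp: simple_graph_def)

text \<open>A pendant edge gives every fixed point infimum 1, and finiteness bounds it. Uniqueness
  of bounded normalized fixed points then makes the description in \<open>canonical_weight\<close>
  meaningful; \<open>w\<close> supplies existence.\<close>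

lemma finite_canonical_weight:
  assumes fin: "finite V" and ne: "E \<noteq> {}" and w: "supersolution G w"
  shows "bounded_normalized_fp G (canonical_weight G)"
proof -
  obtain e where e: "pendant G e" by (rule pendant_exists[OF fin acyclic ne])
  then have eE: "e \<in> E" by (simp add: pendant_def)
  have bnfp: "bounded_normalized_fp G x" if "F_fixed_point G x" for x
  proof -
    have xP: "x \<in> E \<rightarrow>\<^sub>E {1..}" using that by (simp add: F_fixed_point_def)
    have "(INF e\<in>E. x e) = 1"
      using INF_ge_1[OF xP ne] eE pendant_fixed_point[OF that e] by (metis antisym)
    then show ?thesis using that finite_edges[OF fin] by (simp add: bounded_normalized_fp_def)
  qed
  obtain x where "F_fixed_point G x" using fixed_point_below_supersolution[OF w] by metis
  then have "canonical_weight G = x"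
    unfolding canonical_weight_def
    using bnfp bounded_normalized_fp_unique by (intro the_equality) blast+
  then show ?thesis using bnfp[OF \<open>F_fixed_point G x\<close>] by simp
qed

end

lemma tree_graphI: "is_tree G \<Longrightarrow> locally_finite G \<Longrightarrow> tree_graph G"
  by unfold_locales (auto simp: is_tree_def)

lemma finite_imp_locally_finite:
  assumes "simple_graph G" "finite (verts G)"
  shows "locally_finite G"
  unfolding locally_finite_def
proof
  fix x
  have "nbrs G x \<subseteq> verts G" using assms(1) by (auto simp: simple_graph_def nbrs_def)
  then show "finite (nbrs G x)" using assms(2) by (rule finite_subset)
qed

section \<open>Canonical weights along an exhaustion\<close>

locale exhausted_tree = tree_graph +
  fixes w :: "'a set \<Rightarrow> real" and S :: "nat \<Rightarrow> 'a sgraph"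
  assumes w: "bounded_normalized_fp G w" and ne: "E \<noteq> {}" and S: "exhaustion G S"
begin

abbreviation U :: "nat \<Rightarrow> 'a set set" where "U n \<equiv> edges (S n)"

abbreviation c :: "nat \<Rightarrow> 'a set \<Rightarrow> real" where "c n \<equiv> canonical_weight (S n)"

lemmas w_super = bounded_normalized_fp_supersolution[OF w]

lemma S_tree: "tree_graph (S n)" and S_finite: "finite (verts (S n))"
proof -
  show fin: "finite (verts (S n))" using S by (simp add: exhaustion_def)
  have "is_tree (S n)" using S by (simp add: exhaustion_def)
  then show "tree_graph (S n)"
    using fin by (intro tree_graphI finite_imp_locally_finite) (auto simp: is_tree_def)
qed

lemma S_lf: "lf_graph (S n)"
  using S_tree by (simp add: tree_graph_def)

lemma S_sub: "subgraph (S n) G" "subgraph (S n) (S (Suc n))" "U n \<subseteq> E" "U n \<subseteq> U (Suc n)"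
  using S by (auto simp: exhaustion_def subgraph_def)

lemma U_mono: "m \<le> n \<Longrightarrow> U m \<subseteq> U n"
  using S_sub(4) by (rule lift_Suc_mono_le)

lemma eventually_in_U:
  assumes "e \<in> E"
  shows "eventually (\<lambda>n. e \<in> U n) sequentially"
proof -
  have "e \<in> (\<Union>n. U n)" using S assms by (simp add: exhaustion_def)
  then obtain m where "e \<in> U m" by blast
  then show ?thesis using U_mono by (auto simp: eventually_sequentially)
qed

text \<open>An exhaustion may begin with single vertices, hence the condition on \<open>U n\<close>.
  The required supersolution is the restriction of \<open>w\<close>.\<close>

lemma c_fp: "U n \<noteq> {} \<Longrightarrow> bounded_normalized_fp (S n) (c n)"
  by (rule tree_graph.finite_canonical_weight[OF S_tree S_finite _
        supersolution_restrict[OF lf_graph_axioms S_lf S_sub(1) w_super(1)]])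

text \<open>Stated for a general \<open>H\<close> because it serves twice: \<open>H = G\<close>
  bounds the canonical weights by \<open>w\<close>, and \<open>H = S (Suc n)\<close> makes them
  increase.\<close>

lemma c_le_supersolution:
  assumes "U n \<subseteq> edges H" "lf_graph H" "subgraph (S n) H" "supersolution H v" "e \<in> U n"
  shows "c n e \<le> v e"
proof -
  have ne: "U n \<noteq> {}" using assms(5) by auto
  have fin: "finite (U n)" by (rule tree_graph.finite_edges[OF S_tree S_finite])
  have "c n e \<le> restrict v (U n) e"
    using supersolution_restrict[OF assms(2) S_lf assms(3,4)] finite_imageI[OF fin, THEN bdd_above_finite] assms(5)
    by (rule lf_graph.bounded_normalized_fp_le_supersolution[OF S_lf c_fp[OF ne]])
  then show ?thesis using assms(5) by simp
qed

lemma c_le_w: "e \<in> U n \<Longrightarrow> c n e \<le> w e"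
  using c_le_supersolution[OF S_sub(3) lf_graph_axioms S_sub(1) w_super(1)] .

lemma c_super: "U n \<noteq> {} \<Longrightarrow> supersolution (S n) (c n)"
  using lf_graph.bounded_normalized_fp_supersolution(1)[OF S_lf c_fp] .

lemma c_mono:
  assumes "e \<in> U n"
  shows "c n e \<le> c (Suc n) e"
proof -
  have "U (Suc n) \<noteq> {}" using S_sub(4) assms by auto
  then show ?thesis
    using c_le_supersolution[OF S_sub(4) S_lf S_sub(2) c_super] assms by blast
qed

lemma c_ge_1: "e \<in> U n \<Longrightarrow> 1 \<le> c n e"
  using lf_graph.supersolution_ge_1[OF S_lf c_super] by blast

lemma c_convergent:
  assumes "e \<in> E"
  shows "convergent (\<lambda>n. c n e)"
proof -
  obtain m where m: "\<And>n. m \<le> n \<Longrightarrow> e \<in> U n"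
    using eventually_in_U[OF assms] by (auto simp: eventually_sequentially)
  \<comment> \<open>The shift by \<open>m\<close> is needed since \<open>c n e\<close> carries no
    information before \<open>e\<close> belongs to \<open>U n\<close>.\<close>
  have "incseq (\<lambda>n. c (n + m) e)" using m c_mono by (intro incseq_SucI) simp
  moreover have "c (n + m) e \<le> w e" for n using m c_le_w by simp
  ultimately obtain L where "(\<lambda>n. c (n + m) e) \<longlonglongrightarrow> L"
    using incseq_convergent[of "\<lambda>n. c (n + m) e" "w e"] by blast
  then have "(\<lambda>n. c n e) \<longlonglongrightarrow> L" by (rule LIMSEQ_offset)
  then show ?thesis by (rule convergentI)
qed

definition x :: "'a set \<Rightarrow> real" where
  "x = (\<lambda>e\<in>E. lim (\<lambda>n. c n e))"

lemma c_tendsto_x: "e \<in> E \<Longrightarrow> (\<lambda>n. c n e) \<longlonglongrightarrow> x e"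
  using c_convergent by (simp add: x_def convergent_LIMSEQ_iff)

lemma x_bounds:
  assumes "e \<in> E"
  shows "1 \<le> x e" "x e \<le> w e"
proof -
  show "1 \<le> x e"
    using eventually_in_U[OF assms] c_ge_1
    by (intro tendsto_lowerbound[OF c_tendsto_x[OF assms]]) (auto elim: eventually_mono)
  show "x e \<le> w e"
    using eventually_in_U[OF assms] c_le_w
    by (intro tendsto_upperbound[OF c_tendsto_x[OF assms]]) (auto elim: eventually_mono)
qed

text \<open>The finitely many edges at \<open>u\<close> all belong to \<open>U n\<close> from some
  \<open>n\<close> on; then both sides sum over the same edges.\<close>

lemma side_sum_tendsto: "(\<lambda>n. side_sum (S n) u e (c n)) \<longlonglongrightarrow> side_sum G u e x"
proof -
  let ?A = "{f \<in> E. u \<in> f \<and> f \<noteq> e}"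
  have "eventually (\<lambda>n. \<forall>f\<in>?A. f \<in> U n) sequentially"
    using eventually_in_U finite_edges_at by (intro eventually_ball_finite) auto
  then have "eventually (\<lambda>n. sum (c n) ?A = side_sum (S n) u e (c n)) sequentially"
  proof eventually_elim
    case (elim n)
    then have "{f \<in> U n. u \<in> f \<and> f \<noteq> e} = ?A" using S_sub(3)[of n] by auto
    then show ?case by (simp add: side_sum_def)
  qed
  moreover have "(\<lambda>n. sum (c n) ?A) \<longlonglongrightarrow> side_sum G u e x"
    unfolding side_sum_def using c_tendsto_x by (intro tendsto_sum) auto
  ultimately show ?thesis by (rule Lim_transform_eventually[rotated])
qed

lemma x_fp: "F_fixed_point G x"
  unfolding fixed_point_iff
proof (intro conjI allI impI)
  show "x \<in> E \<rightarrow>\<^sub>E {1..}" using x_bounds(1) by (auto simp: x_def)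
  fix u v assume uv: "{u, v} \<in> E"
  let ?r = "\<lambda>n. max 1 (sqrt (side_sum (S n) u {u, v} (c n) * side_sum (S n) v {u, v} (c n)))"
  have "?r \<longlonglongrightarrow> max 1 (sqrt (side_sum G u {u, v} x * side_sum G v {u, v} x))"
    by (intro tendsto_intros side_sum_tendsto)
  moreover have "eventually (\<lambda>n. ?r n = c n {u, v}) sequentially"
    using eventually_in_U[OF uv]
  proof eventually_elim
    case (elim n)
    then have "F_fixed_point (S n) (c n)"
      using lf_graph.bounded_normalized_fp_supersolution(3)[OF S_lf c_fp] by blast
    then show ?case using elim lf_graph.fixed_point_iff[OF S_lf] by metis
  qed
  ultimately have "(\<lambda>n. c n {u, v}) \<longlonglongrightarrow> max 1 (sqrt (side_sum G u {u, v} x * side_sum G v {u, v} x))"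
    by (rule Lim_transform_eventually)
  then show "x {u, v} = max 1 (sqrt (side_sum G u {u, v} x * side_sum G v {u, v} x))"
    using c_tendsto_x[OF uv] LIMSEQ_unique by blast
qed

text \<open>Dividing \<open>x\<close> by its infimum gives \<open>w\<close> by uniqueness, and the
  divisor is at least 1, so \<open>w\<close> lies below \<open>x\<close> as well as above
  it.\<close>

lemma x_eq_w:
  assumes "e \<in> E"
  shows "x e = w e"
proof (rule antisym)
  define k where "k = (INF e\<in>E. x e)"
  have "1 \<le> k"
    unfolding k_def by (rule INF_ge_1(1)) (use x_fp ne in \<open>auto simp: F_fixed_point_def\<close>)
  obtain B where "\<And>e. e \<in> E \<Longrightarrow> w e \<le> B" using w_super(2) by (auto simp: bdd_above_def)
  then have "bdd_above (x ` E)" using x_bounds(2) by (intro bdd_aboveI2[of _ _ B]) (meson order_trans)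
  then have "bounded_normalized_fp G (\<lambda>e\<in>E. x e / k)"
    unfolding k_def by (rule fixed_point_normalize[OF x_fp _ ne])
  then have "w = (\<lambda>e\<in>E. x e / k)" by (rule bounded_normalized_fp_unique[OF w])
  then have "w e = x e / k" using assms by simp
  also have "\<dots> \<le> x e" using \<open>1 \<le> k\<close> x_bounds(1)[OF assms] by (simp add: divide_le_eq mult_le_cancel_left1)
  finally show "w e \<le> x e" .
  show "x e \<le> w e" using x_bounds(2)[OF assms] .
qed

lemma canonical_weight_tendsto: "e \<in> E \<Longrightarrow> (\<lambda>n. c n e) \<longlonglongrightarrow> w e"
  using c_tendsto_x x_eq_w by simp

lemma S_bdd: "bdd_above (c n ` U n)"
  using tree_graph.finite_edges[OF S_tree S_finite] by simp

lemma DN_S: "DN_LLY (S n) = (if U n = {} then 1 else ereal (SUP e\<in>U n. c n e))"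
proof (cases "U n = {}")
  case False
  then show ?thesis
    using tree_graph.bounded_normalized_fp_DN_LLY[OF S_tree c_fp[OF False] False] by simp
qed (simp add: DN_LLY_def)

lemma one_le_SUP:
  assumes "A \<noteq> {}" "bdd_above (f ` A)" "\<And>e. e \<in> A \<Longrightarrow> (1::real) \<le> f e"
  shows "1 \<le> (SUP e\<in>A. f e)"
proof -
  obtain a where "a \<in> A" using assms(1) by blast
  then show ?thesis using assms(3) cSUP_upper[OF _ assms(2)] by (meson order_trans)
qed

lemma DN_S_incseq: "incseq (\<lambda>n. DN_LLY (S n))"
proof (rule incseq_SucI)
  fix n
  show "DN_LLY (S n) \<le> DN_LLY (S (Suc n))"
  proof (cases "U n = {}")
    case True
    then show ?thesis
      using one_le_SUP[OF _ S_bdd c_ge_1, of "Suc n"] by (simp add: DN_S)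
  next
    case False
    then have "U (Suc n) \<noteq> {}" using S_sub(4) by blast
    moreover have "(SUP e\<in>U n. c n e) \<le> (SUP e\<in>U (Suc n). c (Suc n) e)"
      using False S_sub(4) c_mono by (intro cSUP_mono S_bdd) blast+
    ultimately show ?thesis using False by (simp add: DN_S)
  qed
qed

lemma DN_S_tendsto: "(\<lambda>n. DN_LLY (S n)) \<longlonglongrightarrow> DN_LLY G"
proof -
  have DN: "DN_LLY G = ereal (SUP e\<in>E. w e)" by (rule bounded_normalized_fp_DN_LLY[OF w ne])
  have "(SUP n. DN_LLY (S n)) = DN_LLY G"
  proof (rule antisym)
    show "(SUP n. DN_LLY (S n)) \<le> DN_LLY G"
    proof (rule SUP_least)
      fix n
      show "DN_LLY (S n) \<le> DN_LLY G"
      proof (cases "U n = {}")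
        case True
        then show ?thesis
          using one_le_SUP[OF ne w_super(2) supersolution_ge_1[OF w_super(1)]] by (simp add: DN_S DN)
      next
        case False
        then have "(SUP e\<in>U n. c n e) \<le> (SUP e\<in>E. w e)"
          using S_sub(3) c_le_w by (intro cSUP_mono w_super(2)) blast+
        then show ?thesis using False by (simp add: DN_S DN)
      qed
    qed
    \<comment> \<open>Each value of \<open>w\<close> is a limit of values \<open>c n e\<close>,
      which are eventually bounded by \<open>DN_LLY (S n)\<close>; no uniformity in \<open>e\<close>
      is involved.\<close>
    have "ereal (w e) \<le> (SUP n. DN_LLY (S n))" if "e \<in> E" for e
    proof (rule tendsto_upperbound)
      show "(\<lambda>n. ereal (c n e)) \<longlonglongrightarrow> ereal (w e)"
        using canonical_weight_tendsto[OF that] by simp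
      show "\<forall>\<^sub>F n in sequentially. ereal (c n e) \<le> (SUP n. DN_LLY (S n))"
        using eventually_in_U[OF that]
      proof eventually_elim
        case (elim n)
        then have "ereal (c n e) \<le> DN_LLY (S n)"
          using cSUP_upper[OF elim S_bdd] by (auto simp: DN_S)
        then show ?case by (rule order_trans) (rule SUP_upper[OF UNIV_I])
      qed
    qed simp
    then show "DN_LLY G \<le> (SUP n. DN_LLY (S n))"
      unfolding DN ereal_SUP_le_iff[OF ne w_super(2)] by blast
  qed
  then show ?thesis using LIMSEQ_SUP[OF DN_S_incseq] by simp
qed

end

theorem theorem1p6:
  fixes T :: "'a sgraph"
  assumes "is_tree T" and "locally_finite T" and "infinite (verts T)"
  shows "(DN_LLY T < \<infinity> \<longleftrightarrow> (\<exists>x. bounded_normalized_fp T x)) \<and>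
    (DN_LLY T < \<infinity> \<longrightarrow>
      (\<exists>w.
        \<comment> \<open>(a)\<close>
        bounded_normalized_fp T w \<and> (\<forall>x. bounded_normalized_fp T x \<longrightarrow> x = w) \<and>
        optimal T w \<and> normalized_weight T w \<and>
        (\<forall>x. optimal T x \<and> normalized_weight T x \<longrightarrow> x = w) \<and>
        DN_LLY T = (SUP e\<in>edges T. ereal (w e)) \<and>
        \<comment> \<open>(b)\<close>
        (\<forall>x y. {x, y} \<in> edges T \<and> \<not> pendant T {x, y} \<longrightarrow> kappa_LLY T w x y = 0) \<and>
        (\<forall>e. pendant T e \<longrightarrow> w e = 1) \<and>
        \<comment> \<open>(c)\<close>
        (\<forall>S. exhaustion T S \<longrightarrow>
          incseq (\<lambda>n. DN_LLY (S n)) \<and>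
          (\<lambda>n. DN_LLY (S n)) \<longlonglongrightarrow> DN_LLY T \<and>
          (\<forall>e\<in>edges T. (\<lambda>n. canonical_weight (S n) e) \<longlonglongrightarrow> w e))))"
proof (rule conjI)
  interpret tree_graph T using assms by (intro tree_graphI)
  have ne: "edges T \<noteq> {}" by (rule infinite_imp_edges[OF assms(3)])
  show iff: "DN_LLY T < \<infinity> \<longleftrightarrow> (\<exists>x. bounded_normalized_fp T x)" by (rule DN_LLY_finite_iff[OF ne])
  show "DN_LLY T < \<infinity> \<longrightarrow>
      (\<exists>w. bounded_normalized_fp T w \<and> (\<forall>x. bounded_normalized_fp T x \<longrightarrow> x = w) \<and>
        optimal T w \<and> normalized_weight T w \<and>
        (\<forall>x. optimal T x \<and> normalized_weight T x \<longrightarrow> x = w) \<and>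
        DN_LLY T = (SUP e\<in>edges T. ereal (w e)) \<and>
        (\<forall>x y. {x, y} \<in> edges T \<and> \<not> pendant T {x, y} \<longrightarrow> kappa_LLY T w x y = 0) \<and>
        (\<forall>e. pendant T e \<longrightarrow> w e = 1) \<and>
        (\<forall>S. exhaustion T S \<longrightarrow>
          incseq (\<lambda>n. DN_LLY (S n)) \<and>
          (\<lambda>n. DN_LLY (S n)) \<longlonglongrightarrow> DN_LLY T \<and>
          (\<forall>e\<in>edges T. (\<lambda>n. canonical_weight (S n) e) \<longlonglongrightarrow> w e)))"
  proof
    assume "DN_LLY T < \<infinity>"
    then obtain w where w: "bounded_normalized_fp T w" using iff by blast
    note w' = bounded_normalized_fp_supersolution[OF w]
    have exh: "exhausted_tree T w S" if "exhaustion T S" for S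
      using w ne that by unfold_locales
    show "\<exists>w. bounded_normalized_fp T w \<and> (\<forall>x. bounded_normalized_fp T x \<longrightarrow> x = w) \<and>
        optimal T w \<and> normalized_weight T w \<and>
        (\<forall>x. optimal T x \<and> normalized_weight T x \<longrightarrow> x = w) \<and>
        DN_LLY T = (SUP e\<in>edges T. ereal (w e)) \<and>
        (\<forall>x y. {x, y} \<in> edges T \<and> \<not> pendant T {x, y} \<longrightarrow> kappa_LLY T w x y = 0) \<and>
        (\<forall>e. pendant T e \<longrightarrow> w e = 1) \<and>
        (\<forall>S. exhaustion T S \<longrightarrow>
          incseq (\<lambda>n. DN_LLY (S n)) \<and>
          (\<lambda>n. DN_LLY (S n)) \<longlonglongrightarrow> DN_LLY T \<and>
          (\<forall>e\<in>edges T. (\<lambda>n. canonical_weight (S n) e) \<longlonglongrightarrow> w e))"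
    proof (intro exI[of _ w] conjI allI impI ballI w)
      show "x = w" if "bounded_normalized_fp T x" for x
        using bounded_normalized_fp_unique that w .
      show "optimal T w" "normalized_weight T w"
        by (rule bounded_normalized_fp_optimal[OF w ne])+
      show "x = w" if "optimal T x \<and> normalized_weight T x" for x
        using optimal_normalized_unique[OF assms(3) w] that by blast
      show "DN_LLY T = (SUP e\<in>edges T. ereal (w e))"
        using bounded_normalized_fp_DN_LLY[OF w ne] ereal_SUP_bdd[OF ne w'(2)] by simp
      show "kappa_LLY T w x y = 0" if "{x, y} \<in> edges T \<and> \<not> pendant T {x, y}" for x y
        using bounded_normalized_fp_kappa_LLY[OF w] that by blast
      show "w e = 1" if "pendant T e" for e
        using pendant_fixed_point[OF w'(3) that] .
      fix S assume S: "exhaustion T S"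
      show "incseq (\<lambda>n. DN_LLY (S n))" by (rule exhausted_tree.DN_S_incseq[OF exh[OF S]])
      show "(\<lambda>n. DN_LLY (S n)) \<longlonglongrightarrow> DN_LLY T" by (rule exhausted_tree.DN_S_tendsto[OF exh[OF S]])
      show "(\<lambda>n. canonical_weight (S n) e) \<longlonglongrightarrow> w e" if "e \<in> edges T" for e
        by (rule exhausted_tree.canonical_weight_tendsto[OF exh[OF S] that])
    qed
  qed
qed

end
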